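(* (1) For every bipartite $2$-uniform graph $H$ with at least one edge, the two limits below exist and $$\lim_{n\to\infty}\frac{\mathrm{wsat}(n,H)}{n}=\lim_{n\to\infty}\frac{\mathrm{wsat}(K_{n,n},H)}{2n}.$$ (2) For any integers $d\ge 2$ and $1\le r_1\le\dots\le r_d$ we have, as $n\to\infty$, $$\mathrm{wsat}(n,K^d_{r_1,\dots,r_d})=\frac{r_1-1}{(d-1)!}\,n^{d-1}+O(n^{d-2}),$$ where the implied constant may depend on $d,r_1,\dots,r_d$ but not on $n$.
   Context: A $q$-graph is a (finite) $q$-uniform hypergraph, identified with its edge set; $2$-graphs are ordinary graphs. For $q$-graphs $F,H$ and a subgraph $G\subseteq F$ on the same vertex set as $F$, $G$ is weakly $H$-saturated in $F$ if the edges of $F\setminus G$ can be ordered as $e_1,\dots,e_k$ such that for every $i\in\{1,\dots,k\}$ the hypergraph $G\cup\{e_1,\dots,e_i\}$ contains an isomorphic copy of $H$ which contains the edge $e_i$. $\mathrm{wsat}(F,H)$ is the minimum number of edges in a weakly $H$-saturated subgraph of $F$, and $\mathrm{wsat}(n,H)$ denotes $\mathrm{wsat}(F,H)$ for $F$ the complete $q$-graph on $n$ vertices (all $q$-subsets), where $q$ is the uniformity of $H$. $K_{n,n}$ is the complete bipartite graph with both classes of size $n$. $K^d_{r_1,\dots,r_d}$ is the complete $d$-partite $d$-graph: its vertex set is a disjoint union of classes $R_1,\dots,R_d$ with $|R_i|=r_i$, and its edges are all $d$-subsets containing exactly one vertex from each $R_i$. *)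

theory Defs
  imports Complex_Main "HOL-Library.Landau_Symbols"
begin

text \<open>
  Hypergraphs are identified with their edge sets, so a hypergraph has type \<open>'a set set\<close> and its
  vertices are the elements of its edges.
\<close>

definition uniform_hypergraph :: "nat \<Rightarrow> 'a set set \<Rightarrow> bool" where
  "uniform_hypergraph q H \<longleftrightarrow> finite H \<and> (\<forall>e\<in>H. finite e \<and> card e = q)"

definition bipartite_graph :: "'a set set \<Rightarrow> bool" where
  "bipartite_graph H \<longleftrightarrow> uniform_hypergraph 2 H \<and>
     (\<exists>A B. A \<inter> B = {} \<and> A \<union> B = \<Union>H \<and> (\<forall>e\<in>H. card (e \<inter> A) = 1 \<and> card (e \<inter> B) = 1))"

definition isomorphic_hypergraphs :: "'a set set \<Rightarrow> 'b set set \<Rightarrow> bool" where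
  "isomorphic_hypergraphs H K \<longleftrightarrow> (\<exists>f. inj_on f (\<Union>H) \<and> K = (\<lambda>e. f ` e) ` H)"

text \<open>The list \<open>es\<close> is the ordering of \<open>F - G\<close>; step \<open>i\<close> is counted from 0.\<close>

definition weakly_saturated :: "'b set set \<Rightarrow> 'a set set \<Rightarrow> 'a set set \<Rightarrow> bool" where
  "weakly_saturated H F G \<longleftrightarrow> G \<subseteq> F \<and>
     (\<exists>es. distinct es \<and> set es = F - G \<and>
        (\<forall>i<length es. \<exists>K. isomorphic_hypergraphs H K \<and>
           K \<subseteq> G \<union> set (take (Suc i) es) \<and> es ! i \<in> K))"

text \<open>The minimum exists for finite \<open>F\<close>, as \<open>F\<close> is weakly saturated in itself.\<close>

definition wsat :: "'a set set \<Rightarrow> 'b set set \<Rightarrow> nat" where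
  "wsat F H = (LEAST m. \<exists>G. weakly_saturated H F G \<and> card G = m)"

definition complete_hypergraph :: "nat \<Rightarrow> nat \<Rightarrow> nat set set" where
  "complete_hypergraph q n = {e. e \<subseteq> {..<n} \<and> card e = q}"

text \<open>The uniformity \<open>q\<close> of \<open>H\<close> is an explicit argument.\<close>

definition wsat_complete :: "nat \<Rightarrow> nat \<Rightarrow> 'b set set \<Rightarrow> nat" where
  "wsat_complete q n H = wsat (complete_hypergraph q n) H"

definition partite_class :: "(nat \<Rightarrow> nat) \<Rightarrow> nat \<Rightarrow> (nat \<times> nat) set" where
  "partite_class r i = {i} \<times> {..<r i}"

definition complete_partite :: "nat \<Rightarrow> (nat \<Rightarrow> nat) \<Rightarrow> (nat \<times> nat) set set" where
  "complete_partite d r =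
     {e. e \<subseteq> (\<Union>i\<in>{1..d}. partite_class r i) \<and> card e = d \<and>
         (\<forall>i\<in>{1..d}. card (e \<inter> partite_class r i) = 1)}"

definition complete_bipartite :: "nat \<Rightarrow> nat \<Rightarrow> (nat \<times> nat) set set" where
  "complete_bipartite m n = complete_partite 2 (\<lambda>i. if i = 1 then m else n)"

end

theory Submission
  imports Defs "HOL-Combinatorics.Permutations"
begin

text \<open>
  Weak saturation is a closure condition: \<open>G\<close> is weakly \<open>H\<close>-saturated in \<open>F\<close> iff \<open>F\<close> is the only
  part of \<open>F\<close> that contains \<open>G\<close> and cannot gain an edge by completing a copy of \<open>H\<close>. Upper bounds
  on \<open>wsat\<close> are obtained by watching such a closed set grow, without ever writing down an order of the
  edges.
  
  \<^bold>\<open>Bipartite graphs.\<close> Write \<open>w n\<close> for \<open>wsat\<close> in the complete graph on \<open>n\<close> vertices. Two cliques of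
  sizes \<open>m\<close> and \<open>n\<close> that are joined through cores of bounded size percolate to the clique on
  \<open>m + n\<close> vertices, so \<open>w (m + n) \<le> w m + w n + O(1)\<close> (\<open>wsat_complete_subadditive\<close>), and Fekete's argument
  shows that \<open>w n / n\<close> converges. Completing a bounded core inside each class of \<open>K\<^bsub>n,n\<^esub>\<close> gives
  \<open>w (2 n) \<le> wsat K\<^bsub>n,n\<^esub> + O(1)\<close> (\<open>wsat_complete_double_le\<close>). Conversely the bipartite double cover of a
  weakly saturated graph of \<open>K\<^bsub>n\<^esub>\<close> is weakly saturated in \<open>K\<^bsub>n,n\<^esub>\<close>, because a bipartite \<open>H\<close> has
  two disjoint copies in its own double cover; hence \<open>wsat K\<^bsub>n,n\<^esub> \<le> 2 (w n)\<close>
  (\<open>wsat_complete_bipartite_le\<close>). The second ratio is squeezed between two sequences with the limit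
  of the first.
  
  \<^bold>\<open>Complete partite hypergraphs, upper bound.\<close> Fix a core \<open>C\<close> of bounded size and \<open>r 1 - 1\<close> vertices
  in it. Take all edges with two or more vertices in \<open>C\<close>, of which there are \<open>O(n^(d - 2))\<close>, and all edges
  whose only vertex in \<open>C\<close> is one of the chosen ones, at most \<open>(r 1 - 1) * (n choose (d - 1))\<close>. First every
  other edge with one vertex in \<open>C\<close> appears, then every edge that avoids \<open>C\<close>
  (\<open>wsat_complete_partite_upper\<close>).
  
  \<^bold>\<open>Complete partite hypergraphs, lower bound.\<close> Put \<open>s = r 1\<close>, the smallest class size. Let \<open>A\<close> be
  the space of real functions on the vertices \<open>0, \<dots>, n - 1\<close> that are orthogonal to \<open>x^k\<close> for all \<open>k < s - 1\<close>; its
  dimension is \<open>n - (s - 1)\<close> for \<open>n \<ge> s - 1\<close>, and every set of \<open>s\<close> vertices is the exact support of a member of \<open>A\<close>. Given a copy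
  of \<open>H\<close> with classes \<open>S\<^sub>1, \<dots>, S\<^sub>d\<close> and an edge of it, the wedge product of members of \<open>A\<close> supported on \<open>s\<close>
  vertices of each class lies in the exterior power \<open>\<Lambda>\<^sup>d A\<close>, vanishes at all edges outside the copy and
  not at the given edge (\<open>copy_relation\<close>). The steps of a saturation process thus yield a triangular, hence
  independent, family of members of \<open>\<Lambda>\<^sup>d A\<close>, so there are at most \<open>(n - (s - 1)) choose d\<close> steps
  (\<open>wsat_complete_partite_lower\<close>). The exterior algebra is made concrete by alternating functions
  of \<open>d\<close> vertices.
\<close>

section \<open>Weak saturation as percolation\<close>

text \<open>
  The set \<open>X\<close> need not be contained in \<open>F\<close>, which makes the notion monotone in \<open>F\<close>: a set closed in a
  large host graph is closed in each of its subgraphs.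
\<close>

definition copy_closed :: "'b set set \<Rightarrow> 'a set set \<Rightarrow> 'a set set \<Rightarrow> bool" where
  "copy_closed H F X \<longleftrightarrow>
     (\<forall>e K. e \<in> F \<and> isomorphic_hypergraphs H K \<and> e \<in> K \<and> K \<subseteq> insert e X \<longrightarrow> e \<in> X)"

lemma copy_closed_mem:
  "copy_closed H F X \<Longrightarrow> isomorphic_hypergraphs H K \<Longrightarrow> e \<in> F \<Longrightarrow> e \<in> K \<Longrightarrow> K \<subseteq> insert e X \<Longrightarrow> e \<in> X"
  unfolding copy_closed_def by blast

lemma copy_closedD:
  assumes "copy_closed H F X" "inj_on f (\<Union>H)" "h \<in> H" "f ` h \<in> F"
    and "\<And>h'. h' \<in> H \<Longrightarrow> f ` h' \<noteq> f ` h \<Longrightarrow> f ` h' \<in> X"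
  shows "f ` h \<in> X"
proof -
  have "isomorphic_hypergraphs H ((\<lambda>e. f ` e) ` H)"
    unfolding isomorphic_hypergraphs_def using assms(2) by blast
  moreover have "(\<lambda>e. f ` e) ` H \<subseteq> insert (f ` h) X" using assms(5) by blast
  ultimately show ?thesis using assms(1,3,4) unfolding copy_closed_def by blast
qed

lemma copy_closed_subset: "copy_closed H F X \<Longrightarrow> F' \<subseteq> F \<Longrightarrow> copy_closed H F' X"
  unfolding copy_closed_def by blast

lemma weakly_saturatedE:
  assumes "weakly_saturated H F G"
  obtains es where "G \<subseteq> F" "distinct es" "set es = F - G"
    "\<forall>i<length es. \<exists>K. isomorphic_hypergraphs H K \<and>
       K \<subseteq> G \<union> set (take (Suc i) es) \<and> es ! i \<in> K"
  using assms unfolding weakly_saturated_def by (elim exE conjE) (rule that)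

text \<open>
  By induction along the ordering: the copy that justifies the next edge lies, apart from that edge, in the
  part that has already been absorbed by \<open>X\<close>.
\<close>

lemma weakly_saturated_closed_supset:
  assumes "weakly_saturated H F G" "copy_closed H F X" "G \<subseteq> X"
  shows "F \<subseteq> X"
proof -
  obtain es where es: "set es = F - G"
    and step: "\<forall>i<length es. \<exists>K. isomorphic_hypergraphs H K \<and>
           K \<subseteq> G \<union> set (take (Suc i) es) \<and> es ! i \<in> K"
    by (rule weakly_saturatedE[OF assms(1)])
  have "i \<le> length es \<Longrightarrow> set (take i es) \<subseteq> X" for i
  proof (induction i)
    case (Suc i)
    then have i: "i < length es" by simp
    from step[rule_format, OF i] obtain K where K: "isomorphic_hypergraphs H K"
      "K \<subseteq> G \<union> set (take (Suc i) es)" "es ! i \<in> K" by blast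
    have tk: "set (take (Suc i) es) = insert (es ! i) (set (take i es))"
      using i by (simp add: take_Suc_conv_app_nth)
    have "K \<subseteq> insert (es ! i) X" using K(2) tk Suc assms(3) by auto
    moreover have "es ! i \<in> F" using es i nth_mem by fastforce
    ultimately have "es ! i \<in> X" using assms(2) K unfolding copy_closed_def by blast
    then show ?case using tk Suc by auto
  qed simp
  from this[of "length es"] show ?thesis using es assms(3) by auto
qed

text \<open>
  The converse: as long as the current set is not all of \<open>F\<close>, it is not closed, so some edge can be added and
  becomes the next one in the ordering. Together with the previous lemma this replaces orderings by closed
  sets.
\<close>

lemma weakly_saturatedI:
  assumes "finite F" "G \<subseteq> F" "\<And>X. copy_closed H F X \<Longrightarrow> G \<subseteq> X \<Longrightarrow> F \<subseteq> X"
  shows "weakly_saturated H F G"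
  using assms(2,3)
proof (induction "card (F - G)" arbitrary: G)
  case 0
  then have "F = G" using assms(1) by auto
  then show ?case unfolding weakly_saturated_def by (auto intro: exI[of _ "[]"])
next
  case (Suc k)
  then have "\<not> F \<subseteq> G" by auto
  then have "\<not> copy_closed H F G" using Suc.prems(2) by blast
  then obtain e K where e: "e \<in> F" "isomorphic_hypergraphs H K" "e \<in> K" "K \<subseteq> insert e G" "e \<notin> G"
    unfolding copy_closed_def by blast
  have "F - insert e G = (F - G) - {e}" by auto
  then have "k = card (F - insert e G)"
    using Suc.hyps(2) e assms(1) by (simp add: card_Diff_singleton)
  then have "weakly_saturated H F (insert e G)"
    using Suc.hyps(1)[of "insert e G"] Suc.prems e(1) by blast
  then obtain es where es: "distinct es" "set es = F - insert e G"
    and step: "\<forall>i<length es. \<exists>K. isomorphic_hypergraphs H K \<and>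
           K \<subseteq> insert e G \<union> set (take (Suc i) es) \<and> es ! i \<in> K"
    by (rule weakly_saturatedE)
  have "distinct (e # es)" "set (e # es) = F - G" using es e by auto
  moreover have "\<exists>K. isomorphic_hypergraphs H K \<and>
           K \<subseteq> G \<union> set (take (Suc i) (e # es)) \<and> (e # es) ! i \<in> K" if "i < length (e # es)" for i
  proof (cases i)
    case 0
    then show ?thesis using e by (intro exI[of _ K]) auto
  next
    case (Suc j)
    then have "j < length es" using that by simp
    from step[rule_format, OF this] Suc show ?thesis by simp
  qed
  ultimately show ?case unfolding weakly_saturated_def using Suc.prems(1)
    by (intro conjI exI[of _ "e # es"] allI impI)
qed

lemma wsat_le: "weakly_saturated H F G \<Longrightarrow> wsat F H \<le> card G"
  unfolding wsat_def by (rule Least_le) blast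

lemma wsat_attained:
  obtains G where "weakly_saturated H F G" "card G = wsat F H"
proof -
  have "weakly_saturated H F F"
    unfolding weakly_saturated_def by (auto intro: exI[of _ "[]"])
  then have "\<exists>G. weakly_saturated H F G \<and> card G = wsat F H"
    unfolding wsat_def by (intro LeastI_ex[where P="\<lambda>m. \<exists>G. weakly_saturated H F G \<and> card G = m"]) blast
  then show ?thesis using that by blast
qed

lemma isomorphic_hypergraphs_image:
  assumes "isomorphic_hypergraphs H K" "inj_on \<phi> (\<Union>K)"
  shows "isomorphic_hypergraphs H ((`) \<phi> ` K)"
proof -
  obtain f where f: "inj_on f (\<Union>H)" "K = (\<lambda>e. f ` e) ` H"
    using assms(1) unfolding isomorphic_hypergraphs_def by blast
  have "\<Union>K = f ` \<Union>H" using f(2) by auto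
  then have "inj_on (\<phi> \<circ> f) (\<Union>H)" using comp_inj_on[OF f(1)] assms(2) by simp
  moreover have "(`) \<phi> ` K = (\<lambda>e. (\<phi> \<circ> f) ` e) ` H" using f(2) by (auto simp: image_comp)
  ultimately show ?thesis unfolding isomorphic_hypergraphs_def by blast
qed

text \<open>
  A process that takes place in \<open>F\<close> can be replayed inside any host containing an injective image of \<open>F\<close>:
  the preimage of a closed set is closed.
\<close>

lemma weakly_saturated_image_closed_supset:
  assumes "weakly_saturated H F G" "inj_on \<phi> (\<Union>F)"
    and "copy_closed H F' X" "(`) \<phi> ` F \<subseteq> F'" "(`) \<phi> ` G \<subseteq> X"
  shows "(`) \<phi> ` F \<subseteq> X"
proof -
  have GF: "G \<subseteq> F" using assms(1) unfolding weakly_saturated_def by blast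
  have "copy_closed H F {e \<in> F. \<phi> ` e \<in> X}"
    unfolding copy_closed_def
  proof (intro allI impI, elim conjE)
    fix e K assume e: "e \<in> F" "isomorphic_hypergraphs H K" "e \<in> K"
      and K: "K \<subseteq> insert e {e \<in> F. \<phi> ` e \<in> X}"
    have "\<Union>K \<subseteq> \<Union>F" using K e(1) by auto
    then have "isomorphic_hypergraphs H ((`) \<phi> ` K)"
      by (intro isomorphic_hypergraphs_image[OF e(2)] inj_on_subset[OF assms(2)])
    then have "\<phi> ` e \<in> X"
    proof (rule copy_closed_mem[OF assms(3)])
      show "(`) \<phi> ` K \<subseteq> insert (\<phi> ` e) X" "\<phi> ` e \<in> (`) \<phi> ` K" "\<phi> ` e \<in> F'"
        using K e assms(4) by auto
    qed
    then show "e \<in> {e \<in> F. \<phi> ` e \<in> X}" using e by simp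
  qed
  from weakly_saturated_closed_supset[OF assms(1) this] show ?thesis
    using GF assms(5) by blast
qed

lemma finite_complete_hypergraph: "finite (complete_hypergraph q n)"
  unfolding complete_hypergraph_def by (rule finite_subset[of _ "Pow {..<n}"]) auto

lemma doubleton_in_complete:
  "{u, v} \<in> complete_hypergraph 2 n \<longleftrightarrow> u < n \<and> v < n \<and> u \<noteq> v"
  unfolding complete_hypergraph_def by (auto simp: card_insert_if)

lemma complete_hypergraph_2E:
  assumes "e \<in> complete_hypergraph 2 n"
  obtains u v where "e = {u, v}" "u < n" "v < n" "u \<noteq> v"
proof -
  obtain u v where "e = {u, v}" "u \<noteq> v"
    using assms unfolding complete_hypergraph_def by (auto simp: card_2_iff)
  then show ?thesis using that assms by (simp add: doubleton_in_complete)
qed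

section \<open>Completing edges between cores in graphs\<close>

lemma bipartite_graphE:
  assumes "bipartite_graph H"
  obtains A B where "A \<inter> B = {}" "A \<union> B = \<Union>H" "finite (\<Union>H)"
    "\<And>h. h \<in> H \<Longrightarrow> \<exists>a\<in>A. \<exists>b\<in>B. h = {a, b}"
proof -
  obtain A B where AB: "A \<inter> B = {}" "A \<union> B = \<Union>H"
    and one: "\<And>h. h \<in> H \<Longrightarrow> card (h \<inter> A) = 1 \<and> card (h \<inter> B) = 1"
    using assms unfolding bipartite_graph_def by blast
  have "finite (\<Union>H)"
    using assms unfolding bipartite_graph_def uniform_hypergraph_def by auto
  moreover have "\<exists>a\<in>A. \<exists>b\<in>B. h = {a, b}" if h: "h \<in> H" for h
  proof -
    obtain a b where "h \<inter> A = {a}" "h \<inter> B = {b}"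
      using one[OF h] by (meson card_1_singletonE)
    moreover from this have "a \<in> A" "b \<in> B" by blast+
    moreover have "h = (h \<inter> A) \<union> (h \<inter> B)" using AB(2) h by auto
    ultimately have "h = {a, b}" by (metis insert_is_Un)
    then show ?thesis using \<open>a \<in> A\<close> \<open>b \<in> B\<close> by blast
  qed
  ultimately show ?thesis using that AB by blast
qed

text \<open>
  All percolation arguments for graphs below are instances of this one. A copy of \<open>H\<close> through the edge
  \<open>u v\<close> sends one edge of \<open>H\<close> to \<open>u v\<close>, the rest of the class of \<open>u\<close> into \<open>S\<close> and the rest of the class of
  \<open>v\<close> into \<open>T\<close>; all its other edges run between \<open>S \<union> {u}\<close> and \<open>T \<union> {v}\<close>.
\<close>

lemma copy_closed_insert_edge:
  assumes H: "bipartite_graph H" "H \<noteq> {}" and X: "copy_closed H F X"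
    and uv: "{u, v} \<in> F" "u \<noteq> v"
    and ST: "finite S" "finite T" "S \<inter> T = {}" "u \<notin> S \<union> T" "v \<notin> S \<union> T"
      "card (\<Union>H) \<le> card S" "card (\<Union>H) \<le> card T"
    and edges: "\<And>t. t \<in> T \<Longrightarrow> {u, t} \<in> X" "\<And>s. s \<in> S \<Longrightarrow> {s, v} \<in> X"
      "\<And>s t. s \<in> S \<Longrightarrow> t \<in> T \<Longrightarrow> {s, t} \<in> X"
  shows "{u, v} \<in> X"
proof -
  obtain A B where AB: "A \<inter> B = {}" "A \<union> B = \<Union>H" and fin: "finite (\<Union>H)"
    and ed: "\<And>h. h \<in> H \<Longrightarrow> \<exists>a\<in>A. \<exists>b\<in>B. h = {a, b}"
    using bipartite_graphE[OF H(1)] by metis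
  obtain p q where pq: "p \<in> A" "q \<in> B" "{p, q} \<in> H" using H(2) ed by blast
  have finAB: "finite A" "finite B" using AB(2) fin by (metis finite_Un)+
  have "card A \<le> card (\<Union>H)" "card B \<le> card (\<Union>H)"
    using AB(2) by (intro card_mono[OF fin]; blast)+
  then have "card A \<le> card S" "card B \<le> card T" using ST(6,7) by linarith+
  then obtain f1 f2 where f1: "f1 ` A \<subseteq> S" "inj_on f1 A" and f2: "f2 ` B \<subseteq> T" "inj_on f2 B"
    using card_le_inj[OF finAB(1) ST(1)] card_le_inj[OF finAB(2) ST(2)] by blast
  define f where "f x = (if x = p then u else if x = q then v else if x \<in> A then f1 x else f2 x)" for x
  have fA: "f x \<in> S" "f x = f1 x" if "x \<in> A" "x \<noteq> p" for x
    using that f1 pq AB(1) unfolding f_def by auto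
  have fB: "f x \<in> T" "f x = f2 x" if "x \<in> B" "x \<noteq> q" for x
    using that f2 pq AB(1) unfolding f_def by auto
  have fpq: "f p = u" "f q = v" using pq AB(1) unfolding f_def by auto
  have injA: "inj_on f A"
    using fA fpq ST(4) f1(2) unfolding inj_on_def by (metis UnI1)
  have injB: "inj_on f B"
    using fB fpq ST(5) f2(2) unfolding inj_on_def by (metis UnI2)
  have "f a \<noteq> f b" if "a \<in> A" "b \<in> B" for a b
    using that fA(1)[of a] fB(1)[of b] fpq ST(3,4,5) uv(2) by (cases "a = p"; cases "b = q") auto
  then have "inj_on f (A \<union> B)" using injA injB by (subst inj_on_Un) blast
  then have inj: "inj_on f (\<Union>H)" using AB(2) by simp
  have "f ` {p, q} \<in> X"
  proof (rule copy_closedD[OF X inj pq(3)])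
    show "f ` {p, q} \<in> F" using fpq uv by simp
    fix h assume h: "h \<in> H" "f ` h \<noteq> f ` {p, q}"
    obtain a b where ab: "a \<in> A" "b \<in> B" "h = {a, b}" using ed[OF h(1)] by blast
    show "f ` h \<in> X"
      using ab h(2) fA(1)[of a] fB(1)[of b] fpq edges by (cases "a = p"; cases "b = q") auto
  qed
  then show ?thesis using fpq by simp
qed

section \<open>Comparing complete graphs of different sizes\<close>

text \<open>
  Each of the two cliques is generated by an optimal set of its own. The bounded extra set joins a core of the
  first clique completely to a core of the second; each core has twice as many vertices as \<open>H\<close>, so that it
  can be split into the sets \<open>S\<close> and \<open>T\<close> of the previous lemma. First the core of the second clique gets
  joined to the whole first clique, working in the first core, and then everything gets joined, working
  in the second core.
\<close>

lemma wsat_complete_subadditive: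
  assumes H: "bipartite_graph H" "H \<noteq> {}"
    and m: "2 * card (\<Union>H) \<le> m" "2 * card (\<Union>H) \<le> n"
  shows "wsat_complete 2 (m + n) H \<le> wsat_complete 2 m H + wsat_complete 2 n H + (2 * card (\<Union>H))\<^sup>2"
proof -
  define c where "c = card (\<Union>H)"
  define shift where "shift = (`) ((+) m)"
  obtain G1 where G1: "weakly_saturated H (complete_hypergraph 2 m) G1" "card G1 = wsat_complete 2 m H"
    using wsat_attained unfolding wsat_complete_def by blast
  obtain G2 where G2: "weakly_saturated H (complete_hypergraph 2 n) G2" "card G2 = wsat_complete 2 n H"
    using wsat_attained unfolding wsat_complete_def by blast
  define J where "J = (\<lambda>(x, y). {x, y}) ` ({..<2 * c} \<times> {m..<m + 2 * c})"
  define G where "G = G1 \<union> shift ` G2 \<union> J"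
  have sub: "G1 \<subseteq> complete_hypergraph 2 m" "G2 \<subseteq> complete_hypergraph 2 n"
    using G1 G2 unfolding weakly_saturated_def by blast+
  have mono: "complete_hypergraph 2 m \<subseteq> complete_hypergraph 2 (m + n)"
    unfolding complete_hypergraph_def by auto
  have shift: "shift ` complete_hypergraph 2 n \<subseteq> complete_hypergraph 2 (m + n)"
  proof (clarify elim!: complete_hypergraph_2E)
    fix u v assume "u < n" "v < n" "u \<noteq> v"
    then show "shift {u, v} \<in> complete_hypergraph 2 (m + n)"
      unfolding shift_def by (simp add: doubleton_in_complete)
  qed
  have J: "J \<subseteq> complete_hypergraph 2 (m + n)"
    using m unfolding J_def c_def by (auto simp: doubleton_in_complete)
  have "weakly_saturated H (complete_hypergraph 2 (m + n)) G"
  proof (rule weakly_saturatedI)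
    show "G \<subseteq> complete_hypergraph 2 (m + n)" unfolding G_def using sub mono shift J by blast
  next
    fix X assume X: "copy_closed H (complete_hypergraph 2 (m + n)) X" and GX: "G \<subseteq> X"
    have X1: "complete_hypergraph 2 m \<subseteq> X"
      using weakly_saturated_closed_supset[OF G1(1) copy_closed_subset[OF X mono]] GX
      unfolding G_def by blast
    have "shift ` complete_hypergraph 2 n \<subseteq> X" unfolding shift_def
      by (rule weakly_saturated_image_closed_supset[OF G2(1) _ X])
        (use shift GX in \<open>auto simp: G_def shift_def\<close>)
    then have "shift {u, v} \<in> X" if "u < n" "v < n" "u \<noteq> v" for u v
      using that by (auto simp: doubleton_in_complete)
    then have X2': "{m + u, m + v} \<in> X" if "u < n" "v < n" "u \<noteq> v" for u v
      using that unfolding shift_def by simp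
    have X2: "{u, v} \<in> X" if "m \<le> u" "m \<le> v" "u < m + n" "v < m + n" "u \<noteq> v" for u v
      using X2'[of "u - m" "v - m"] that by simp
    have X1: "{u, v} \<in> X" if "u < m" "v < m" "u \<noteq> v" for u v
      using X1 that by (auto simp: doubleton_in_complete)
    have XJ: "{x, y} \<in> X" if "x < 2 * c" "m \<le> y" "y < m + 2 * c" for x y
    proof -
      have "{x, y} \<in> J" using that unfolding J_def by (intro image_eqI[of _ _ "(x, y)"]) auto
      then show ?thesis using GX unfolding G_def by blast
    qed
    \<comment> \<open>The core of the first clique lets \<open>u\<close> reach the core of the second clique.\<close>
    have X3: "{u, y} \<in> X" if "u < m" "m \<le> y" "y < m + 2 * c" for u y
    proof (cases "u < 2 * c")
      case False
      show ?thesis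
      proof (rule copy_closed_insert_edge[OF H X, where S = "{..<c}" and T = "{c..<2 * c}"])
        show "{u, t} \<in> X" if "t \<in> {c..<2 * c}" for t
          using that False \<open>u < m\<close> m by (intro X1) (auto simp: c_def[symmetric])
        show "{s, y} \<in> X" if "s \<in> {..<c}" for s
          using that \<open>m \<le> y\<close> \<open>y < m + 2 * c\<close> by (intro XJ) auto
        show "{s, t} \<in> X" if "s \<in> {..<c}" "t \<in> {c..<2 * c}" for s t
          using that m by (intro X1) (auto simp: c_def[symmetric])
      qed (use False that m in \<open>auto simp: doubleton_in_complete c_def[symmetric]\<close>)
    qed (use XJ that in auto)
    \<comment> \<open>Now \<open>u\<close> and \<open>v\<close> are both joined to the core of the second clique.\<close>
    have X4: "{u, v} \<in> X" if "u < m" "m \<le> v" "v < m + n" for u v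
    proof (cases "v < m + 2 * c")
      case False
      show ?thesis
      proof (rule copy_closed_insert_edge[OF H X, where S = "{m..<m + c}" and T = "{m + c..<m + 2 * c}"])
        show "{u, t} \<in> X" if "t \<in> {m + c..<m + 2 * c}" for t
          using that \<open>u < m\<close> by (intro X3) auto
        show "{s, v} \<in> X" if "s \<in> {m..<m + c}" for s
          using that False \<open>v < m + n\<close> m by (intro X2) (auto simp: c_def[symmetric])
        show "{s, t} \<in> X" if "s \<in> {m..<m + c}" "t \<in> {m + c..<m + 2 * c}" for s t
          using that m by (intro X2) (auto simp: c_def[symmetric])
      qed (use False that m in \<open>auto simp: doubleton_in_complete c_def[symmetric]\<close>)
    qed (use X3 that in auto)
    show "complete_hypergraph 2 (m + n) \<subseteq> X"
    proof (clarify elim!: complete_hypergraph_2E)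
      fix u v assume uv: "u < m + n" "v < m + n" "u \<noteq> v"
      show "{u, v} \<in> X"
        using X1[of u v] X2[of u v] X4[of u v] X4[of v u] uv
        by (cases "u < m"; cases "v < m") (auto simp: insert_commute)
    qed
  qed (rule finite_complete_hypergraph)
  then have "wsat_complete 2 (m + n) H \<le> card G"
    unfolding wsat_complete_def by (rule wsat_le)
  also have "card G \<le> card G1 + card (shift ` G2) + card J"
    unfolding G_def by (meson add_le_mono card_Un_le le_refl le_trans)
  also have "card (shift ` G2) \<le> card G2"
    using sub finite_complete_hypergraph finite_subset card_image_le by metis
  also have "card J \<le> card ({..<2 * c} \<times> {m..<m + 2 * c})"
    unfolding J_def by (rule card_image_le) simp
  also have "\<dots> = (2 * c)\<^sup>2" by (simp add: power2_eq_square)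
  finally show ?thesis using G1 G2 c_def by simp
qed

section \<open>Comparing complete and complete bipartite graphs\<close>

lemma doubleton_in_complete_bipartite:
  "e \<in> complete_bipartite m n \<longleftrightarrow> (\<exists>i<m. \<exists>j<n. e = {(1, i), (2, j)})"
proof
  have classes: "{Suc 0..2} = {Suc 0, 2}" by auto
  assume e: "e \<in> complete_bipartite m n"
  then have sub: "e \<subseteq> {1} \<times> {..<m} \<union> {2} \<times> {..<n}"
    and "card (e \<inter> {1} \<times> {..<m}) = 1" "card (e \<inter> {2} \<times> {..<n}) = 1"
    unfolding complete_bipartite_def complete_partite_def partite_class_def by (auto simp: classes)
  then obtain x y where xy: "e \<inter> {1} \<times> {..<m} = {x}" "e \<inter> {2} \<times> {..<n} = {y}"
    by (meson card_1_singletonE)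
  have "e = e \<inter> {1} \<times> {..<m} \<union> e \<inter> {2} \<times> {..<n}" using sub by auto
  then have "e = {x, y}" using xy by auto
  moreover obtain i where "x = (1, i)" "i < m" using xy(1) by auto
  moreover obtain j where "y = (2, j)" "j < n" using xy(2) by auto
  ultimately show "\<exists>i<m. \<exists>j<n. e = {(1, i), (2, j)}" by blast
next
  have classes: "{Suc 0..2} = {Suc 0, 2}" by auto
  assume "\<exists>i<m. \<exists>j<n. e = {(1, i), (2, j)}"
  then show "e \<in> complete_bipartite m n"
    unfolding complete_bipartite_def complete_partite_def partite_class_def
    by (auto simp: classes)
qed

lemma finite_complete_bipartite: "finite (complete_bipartite m n)"
proof -
  have "complete_bipartite m n \<subseteq> (\<lambda>(i, j). {(1, i), (2, j)}) ` ({..<m} \<times> {..<n})"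
    by (auto simp: doubleton_in_complete_bipartite)
  then show ?thesis by (rule finite_subset) simp
qed

text \<open>
  The extra edges are two cliques \<open>J\<close>, one in each class. Inside a class, a vertex outside the core first gets
  joined to the core, with \<open>S\<close> in the core and \<open>T\<close> the whole opposite class; then any two vertices
  of the class get joined in the same way.
\<close>

lemma wsat_complete_double_le:
  assumes H: "bipartite_graph H" "H \<noteq> {}" and n: "2 * card (\<Union>H) \<le> n"
  shows "wsat_complete 2 (2 * n) H \<le> wsat (complete_bipartite n n) H + 2 * (2 * card (\<Union>H))\<^sup>2"
proof -
  define c where "c = card (\<Union>H)"
  define \<phi> :: "nat \<times> nat \<Rightarrow> nat" where "\<phi> = (\<lambda>(i, j). if i = 1 then j else n + j)"
  obtain G1 where G1: "weakly_saturated H (complete_bipartite n n) G1"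
    "card G1 = wsat (complete_bipartite n n) H"
    using wsat_attained by blast
  define J where "J k = (\<lambda>(x, y). {x, y}) ` {(x, y). x \<in> {k..<k + 2 * c} \<and> y \<in> {k..<k + 2 * c} \<and> x \<noteq> y}" for k :: nat
  define G where "G = (`) \<phi> ` G1 \<union> J 0 \<union> J n"
  let ?F = "complete_hypergraph 2 (2 * n)"
  have sub: "G1 \<subseteq> complete_bipartite n n"
    using G1 unfolding weakly_saturated_def by blast
  have \<phi>: "(`) \<phi> ` complete_bipartite n n \<subseteq> ?F"
    by (auto simp: doubleton_in_complete_bipartite doubleton_in_complete \<phi>_def)
  have inj: "inj_on \<phi> (\<Union>(complete_bipartite n n))"
  proof (rule inj_onI)
    fix x y assume xy: "x \<in> \<Union>(complete_bipartite n n)" "y \<in> \<Union>(complete_bipartite n n)" "\<phi> x = \<phi> y"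
    have "\<exists>j<n. z = (1, j) \<or> z = (2, j)" if "z \<in> \<Union>(complete_bipartite n n)" for z
      using that by (auto simp: doubleton_in_complete_bipartite)
    from this[OF xy(1)] this[OF xy(2)] xy(3) show "x = y" unfolding \<phi>_def by auto
  qed
  have J: "J k \<subseteq> ?F" if "k \<le> n" for k
    using n that unfolding J_def c_def by (auto simp: doubleton_in_complete)
  have "weakly_saturated H ?F G"
  proof (rule weakly_saturatedI)
    show "G \<subseteq> ?F" unfolding G_def using sub \<phi> J[of 0] J[of n] by blast
  next
    fix X assume X: "copy_closed H ?F X" and GX: "G \<subseteq> X"
    have \<phi>X: "(`) \<phi> ` complete_bipartite n n \<subseteq> X"
      by (rule weakly_saturated_image_closed_supset[OF G1(1) inj X \<phi>]) (use GX G_def in auto)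
    have X1': "{u, n + w} \<in> X" if "u < n" "w < n" for u w
    proof (rule subsetD[OF \<phi>X], rule image_eqI[of _ _ "{(1, u), (2, w)}"])
    qed (use that in \<open>auto simp: \<phi>_def doubleton_in_complete_bipartite\<close>)
    have X1: "{u, v} \<in> X" if "u < n" "n \<le> v" "v < 2 * n" for u v
      using X1'[of u "v - n"] that by simp
    \<comment> \<open>\<open>k\<close> is the first vertex of one side, \<open>l\<close> the first vertex of the other.\<close>
    have side: "{u, v} \<in> X" if kl: "(k, l) \<in> {(0, n), (n, 0)}"
      and uv: "k \<le> u" "u < k + n" "k \<le> v" "v < k + n" "u \<noteq> v" for k l u v
    proof -
      have XJ: "{x, y} \<in> X" if "k \<le> x" "x < k + 2 * c" "k \<le> y" "y < k + 2 * c" "x \<noteq> y" for x y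
      proof -
        have "{x, y} \<in> J k" using that unfolding J_def by (intro image_eqI[of _ _ "(x, y)"]) auto
        then show ?thesis using GX kl unfolding G_def by blast
      qed
      have X1: "{x, y} \<in> X" if "k \<le> x" "x < k + n" "l \<le> y" "y < l + n" for x y
      proof (cases "k = 0")
        case True
        then show ?thesis using kl that X1[of x y] by auto
      next
        case False
        then have "{y, x} \<in> X" using kl that X1[of y x] by auto
        then show ?thesis by (simp only: insert_commute)
      qed
      have F: "{x, y} \<in> ?F" if "k \<le> x" "x < k + n" "k \<le> y" "y < k + n" "x \<noteq> y" for x y
        using that kl by (auto simp: doubleton_in_complete)
      have nc: "2 * c \<le> n" using n unfolding c_def .
      have disj: "{k..<k + n} \<inter> {l..<l + n} = {}" using kl by auto
      have core: "{x, y} \<in> X" if x: "k + 2 * c \<le> x" "x < k + n" and y: "k \<le> y" "y < k + 2 * c" for x y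
      proof (rule copy_closed_insert_edge[OF H X])
        show "card (\<Union>H) \<le> card ({k..<k + 2 * c} - {y})" using y by (simp add: c_def[symmetric])
        show "card (\<Union>H) \<le> card {l..<l + n}" using n by simp
        show "({k..<k + 2 * c} - {y}) \<inter> {l..<l + n} = {}" using disj nc by (fastforce simp: set_eq_iff)
        show "{x, y} \<in> ?F" using x y nc by (intro F) auto
        show "x \<notin> {k..<k + 2 * c} - {y} \<union> {l..<l + n}" "y \<notin> {k..<k + 2 * c} - {y} \<union> {l..<l + n}"
          using disj x y nc by (fastforce simp: set_eq_iff)+
        show "{x, t} \<in> X" if "t \<in> {l..<l + n}" for t
          using that x by (intro X1) auto
        show "{s, y} \<in> X" if "s \<in> {k..<k + 2 * c} - {y}" for s
          using that y by (intro XJ) auto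
        show "{s, t} \<in> X" if "s \<in> {k..<k + 2 * c} - {y}" "t \<in> {l..<l + n}" for s t
          using that nc by (intro X1) auto
      qed (use x y in auto)
      show ?thesis
      proof (cases "u < k + 2 * c \<or> v < k + 2 * c")
        case True
        then show ?thesis using uv core[of u v] core[of v u] XJ[of u v]
          by (cases "u < k + 2 * c"; cases "v < k + 2 * c") (simp_all add: insert_commute)
      next
        case False
        show ?thesis
        proof (rule copy_closed_insert_edge[OF H X])
          show "card (\<Union>H) \<le> card {k..<k + 2 * c}" by (simp add: c_def[symmetric])
          show "card (\<Union>H) \<le> card {l..<l + n}" using n by simp
          show "{k..<k + 2 * c} \<inter> {l..<l + n} = {}" using disj nc by (fastforce simp: set_eq_iff)
          show "{u, v} \<in> ?F" using uv by (intro F) auto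
          show "u \<notin> {k..<k + 2 * c} \<union> {l..<l + n}" "v \<notin> {k..<k + 2 * c} \<union> {l..<l + n}"
            using disj uv False by (fastforce simp: set_eq_iff)+
          show "{u, t} \<in> X" if "t \<in> {l..<l + n}" for t
            using that uv by (intro X1) auto
          show "{s, v} \<in> X" if "s \<in> {k..<k + 2 * c}" for s
            using core[of v s] that False uv by (simp add: insert_commute)
          show "{s, t} \<in> X" if "s \<in> {k..<k + 2 * c}" "t \<in> {l..<l + n}" for s t
            using that nc by (intro X1) auto
        qed (use uv in auto)
      qed
    qed
    show "?F \<subseteq> X"
    proof (clarify elim!: complete_hypergraph_2E)
      fix u v assume uv: "u < 2 * n" "v < 2 * n" "u \<noteq> v"
      show "{u, v} \<in> X"
      proof (cases "u < n"; cases "v < n")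
        assume "u < n" "v < n"
        then show ?thesis using uv by (intro side[of 0 n]) auto
      next
        assume "u < n" "\<not> v < n"
        then show ?thesis using uv by (intro X1) auto
      next
        assume "\<not> u < n" "v < n"
        then have "{v, u} \<in> X" using uv by (intro X1) auto
        then show ?thesis by (simp only: insert_commute)
      next
        assume "\<not> u < n" "\<not> v < n"
        then show ?thesis using uv by (intro side[of n 0]) auto
      qed
    qed
  qed (rule finite_complete_hypergraph)
  then have "wsat_complete 2 (2 * n) H \<le> card G"
    unfolding wsat_complete_def by (rule wsat_le)
  also have "card G \<le> card ((`) \<phi> ` G1) + card (J 0) + card (J n)"
    unfolding G_def by (meson add_le_mono card_Un_le le_refl le_trans)
  also have "card ((`) \<phi> ` G1) \<le> card G1"
    using sub finite_complete_bipartite finite_subset card_image_le by metis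
  finally have le: "wsat_complete 2 (2 * n) H \<le> card G1 + card (J 0) + card (J n)" by simp
  have "card (J k) \<le> (2 * c)\<^sup>2" for k
  proof -
    have "J k \<subseteq> (\<lambda>(x, y). {x, y}) ` ({k..<k + 2 * c} \<times> {k..<k + 2 * c})"
      unfolding J_def by auto
    then have "card (J k) \<le> card ({k..<k + 2 * c} \<times> {k..<k + 2 * c})"
      by (rule surj_card_le[rotated]) simp
    then show ?thesis by (simp add: power2_eq_square)
  qed
  from this[of 0] this[of n] le show ?thesis using G1 unfolding c_def by linarith
qed

text \<open>
  The double cover has vertices \<open>(1, u)\<close>, \<open>(2, u)\<close>, and every edge \<open>u v\<close> lifts to the two edges \<open>(1, u) (2, v)\<close> and
  \<open>(1, v) (2, u)\<close>. If \<open>u v\<close> completes a copy of \<open>H\<close> below, then sending one class of the copy to level 1 and the other to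
  level 2 gives a lifted copy through the first lift, and exchanging the levels gives one through the second.
  So both lifts can be added whenever \<open>u v\<close> can. This generates everything but the
  perfect matching \<open>(1, v) (2, v)\<close>, whose edges are easily completed.
\<close>

lemma wsat_complete_bipartite_le:
  assumes H: "bipartite_graph H" "H \<noteq> {}" and n: "2 * card (\<Union>H) < n"
  shows "wsat (complete_bipartite n n) H \<le> 2 * wsat_complete 2 n H"
proof -
  define c where "c = card (\<Union>H)"
  obtain G1 where G1: "weakly_saturated H (complete_hypergraph 2 n) G1"
    "card G1 = wsat_complete 2 n H"
    using wsat_attained unfolding wsat_complete_def by blast
  have sub: "G1 \<subseteq> complete_hypergraph 2 n"
    using G1 unfolding weakly_saturated_def by blast
  define lift :: "nat \<times> nat \<Rightarrow> (nat \<times> nat) set" where "lift = (\<lambda>(u, v). {(1, u), (2, v)})"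
  define G where "G = (\<Union>e\<in>G1. lift ` {(u, v). e = {u, v}})"
  let ?F = "complete_bipartite n n"
  obtain A B where AB: "A \<inter> B = {}" "A \<union> B = \<Union>H" and fin: "finite (\<Union>H)"
    and ed: "\<And>h. h \<in> H \<Longrightarrow> \<exists>a\<in>A. \<exists>b\<in>B. h = {a, b}"
    using bipartite_graphE[OF H(1)] by metis
  have "weakly_saturated H ?F G"
  proof (rule weakly_saturatedI)
    have "lift (u, v) \<in> ?F" if "{u, v} \<in> G1" for u v
    proof -
      have "u < n" "v < n" using sub that doubleton_in_complete[of u v n] by auto
      then show ?thesis unfolding lift_def doubleton_in_complete_bipartite by auto
    qed
    then show "G \<subseteq> ?F" unfolding G_def by auto
  next
    fix X assume X: "copy_closed H ?F X" and GX: "G \<subseteq> X"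
    \<comment> \<open>The edges both of whose lifts are present form a closed set of the complete graph.\<close>
    define Y where "Y = {e. \<forall>u v. e = {u, v} \<longrightarrow> lift (u, v) \<in> X}"
    have "copy_closed H (complete_hypergraph 2 n) Y"
      unfolding copy_closed_def
    proof (intro allI impI, elim conjE)
      fix e K assume e: "e \<in> complete_hypergraph 2 n" "isomorphic_hypergraphs H K" "e \<in> K"
        and K: "K \<subseteq> insert e Y"
      obtain f where f: "inj_on f (\<Union>H)" "K = (\<lambda>e. f ` e) ` H"
        using e(2) unfolding isomorphic_hypergraphs_def by blast
      have "lift (u, v) \<in> X" if uv: "e = {u, v}" for u v
      proof -
        have uv': "u < n" "v < n" "u \<noteq> v" using e(1) uv doubleton_in_complete by auto
        obtain h where h: "h \<in> H" "e = f ` h" using e(3) f(2) by auto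
        obtain a0 b0 where ab0: "a0 \<in> A" "b0 \<in> B" "h = {a0, b0}" using ed[OF h(1)] by blast
        \<comment> \<open>The side of \<open>H\<close> that contains the vertex mapped to \<open>u\<close> goes to the first class.\<close>
        obtain P Q where PQ: "P \<inter> Q = {}" "P \<union> Q = \<Union>H"
            "\<And>h. h \<in> H \<Longrightarrow> \<exists>a\<in>P. \<exists>b\<in>Q. h = {a, b}"
          and ab: "\<exists>a\<in>P. \<exists>b\<in>Q. h = {a, b} \<and> f a = u \<and> f b = v"
        proof (cases "f a0 = u")
          case True
          then have "f b0 = v" using uv h ab0 uv' by (auto simp: doubleton_eq_iff)
          then show ?thesis using True ab0 that[of A B] AB ed by blast
        next
          case False
          then have "f b0 = u" "f a0 = v" using uv h ab0 uv' by (auto simp: doubleton_eq_iff)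
          moreover have "\<exists>a\<in>B. \<exists>b\<in>A. h = {a, b}" if "h \<in> H" for h
            using ed[OF that] by (metis insert_commute)
          ultimately show ?thesis using ab0 that[of B A] AB by (metis Int_commute Un_commute insert_commute)
        qed
        then obtain a b where ab: "a \<in> P" "b \<in> Q" "h = {a, b}" "f a = u" "f b = v" by blast
        define g :: "'a \<Rightarrow> nat \<times> nat" where "g x = (if x \<in> P then 1 else 2, f x)" for x
        have inj: "inj_on g (\<Union>H)"
          using f(1) unfolding inj_on_def g_def by auto
        have gh: "g ` {x, y} = lift (f x, f y)" if "x \<in> P" "y \<in> Q" for x y
          using that PQ(1) unfolding g_def lift_def by auto
        have "g ` h \<in> X"
        proof (rule copy_closedD[OF X inj h(1)])
          show "g ` h \<in> ?F"
            using uv' unfolding ab(3) gh[OF ab(1,2)] ab(4,5) lift_def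
            by (auto simp: doubleton_in_complete_bipartite)
          fix h' assume h': "h' \<in> H" "g ` h' \<noteq> g ` h"
          obtain x y where xy: "x \<in> P" "y \<in> Q" "h' = {x, y}" using PQ(3)[OF h'(1)] by blast
          have "h' \<noteq> h" using h'(2) by auto
          then have "f ` h' \<noteq> f ` h"
            using inj_on_image_eq_iff[OF f(1), of h' h] h'(1) h(1) by blast
          then have "f ` h' \<in> Y" using K h' f(2) h(2) by auto
          then have "lift (f x, f y) \<in> X" unfolding Y_def xy(3) by auto
          then show "g ` h' \<in> X" using gh xy by simp
        qed
        then show ?thesis using ab gh[OF ab(1,2)] by simp
      qed
      then show "e \<in> Y" unfolding Y_def by blast
    qed
    moreover have "G1 \<subseteq> Y" using GX unfolding G_def Y_def by blast
    ultimately have "complete_hypergraph 2 n \<subseteq> Y"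
      using weakly_saturated_closed_supset[OF G1(1)] by blast
    then have off: "{(1, u), (2, v)} \<in> X" if "u < n" "v < n" "u \<noteq> v" for u v
      using that doubleton_in_complete[of u v n] unfolding Y_def lift_def by fastforce
    \<comment> \<open>A matching edge is completed inside the cover of \<open>2 * c\<close> further vertices, split into two halves.\<close>
    have diag: "{(1, v), (2, v)} \<in> X" if v: "v < n" for v
    proof -
      have "2 * c \<le> card ({..<n} - {v})" using n v by (simp add: c_def)
      then obtain Z where Z: "Z \<subseteq> {..<n} - {v}" "card Z = 2 * c" "finite Z"
        by (meson obtain_subset_with_card_n)
      then obtain S where S: "S \<subseteq> Z" "card S = c"
        by (metis obtain_subset_with_card_n le_add1 mult_2)
      have cards: "card ({1 :: nat} \<times> S) = c" "card ({2 :: nat} \<times> (Z - S)) = c" "finite S"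
        using S Z by (auto simp: card_Diff_subset finite_subset card_cartesian_product)
      have offX: "{(1, x), (2, y)} \<in> X" if "x \<in> insert v Z" "y \<in> insert v Z" "x \<noteq> y" for x y
        using that Z(1) v by (intro off) auto
      show ?thesis
      proof (rule copy_closed_insert_edge[OF H X, where S = "{1} \<times> S" and T = "{2} \<times> (Z - S)"])
        show "{(1, v), t} \<in> X" if "t \<in> {2} \<times> (Z - S)" for t
          using that Z(1) offX[of v] by auto
        show "{s, (2, v)} \<in> X" if "s \<in> {1} \<times> S" for s
          using that Z(1) S(1) offX[of _ v] by auto
        show "{s, t} \<in> X" if "s \<in> {1} \<times> S" "t \<in> {2} \<times> (Z - S)" for s t
          using that Z(1) S(1) offX by auto
        show "{(1, v), (2, v)} \<in> ?F" using v by (auto simp: doubleton_in_complete_bipartite)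
      qed (use S Z v cards in \<open>auto simp: c_def[symmetric]\<close>)
    qed
    show "?F \<subseteq> X"
    proof
      fix e assume "e \<in> ?F"
      then have "\<exists>i<n. \<exists>j<n. e = {(1, i), (2, j)}" by (rule iffD1[OF doubleton_in_complete_bipartite])
      then obtain i j where ij: "i < n" "j < n" and e: "e = {(1, i), (2, j)}" by (elim exE conjE)
      show "e \<in> X"
      proof (cases "i = j")
        case True
        show ?thesis unfolding e True by (rule diag[OF ij(2)])
      next
        case False
        show ?thesis unfolding e by (rule off[OF ij False])
      qed
    qed
  qed (rule finite_complete_bipartite)
  then have "wsat ?F H \<le> card G" by (rule wsat_le)
  also have "card G \<le> (\<Sum>e\<in>G1. card (lift ` {(u, v). e = {u, v}}))"
    unfolding G_def using sub finite_complete_hypergraph finite_subset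
    by (intro card_UN_le) blast
  also have "\<dots> \<le> (\<Sum>e\<in>G1. 2)"
  proof (rule sum_mono)
    fix e assume "e \<in> G1"
    then obtain u v where "e = {u, v}" using sub complete_hypergraph_2E by blast
    then have "{(u, v). e = {u, v}} = {(u, v), (v, u)}" by (auto simp: doubleton_eq_iff)
    then show "card (lift ` {(u, v). e = {u, v}}) \<le> 2"
      by (auto simp: card_insert_if)
  qed
  finally show ?thesis using G1(2) by simp
qed

section \<open>The two limits for bipartite graphs\<close>

text \<open>
  Fekete's argument. The constant is absorbed by passing to \<open>b n = a n + k\<close>. Subadditivity is available
  only for arguments at least \<open>N\<close>, so division with remainder is applied to \<open>n - M\<close>: it leaves a remainder
  in \<open>[M, M + m)\<close>, where \<open>b\<close> is bounded.
\<close>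

lemma almost_subadditive_converges:
  fixes a :: "nat \<Rightarrow> nat"
  assumes sub: "\<And>m n. N \<le> m \<Longrightarrow> N \<le> n \<Longrightarrow> a (m + n) \<le> a m + a n + k"
  shows "\<exists>L :: real. (\<lambda>n. real (a n) / real n) \<longlonglongrightarrow> L"
proof -
  \<comment> \<open>The maximum with 1 keeps the period \<open>m\<close> of the division below positive.\<close>
  define M where "M = max 1 N"
  define b where "b n = real (a n + k)" for n
  have bsub: "b (m + n) \<le> b m + b n" if "M \<le> m" "M \<le> n" for m n
    using sub[of m n] that unfolding b_def M_def by simp
  have bmult: "b (q * m + r) \<le> real q * b m + b r" if "M \<le> m" "M \<le> r" for q m r
  proof (induction q)
    case (Suc q)
    have "b (m + (q * m + r)) \<le> b m + b (q * m + r)" using that by (intro bsub) auto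
    then show ?case using Suc by (simp add: algebra_simps)
  qed simp
  define L where "L = Inf ((\<lambda>n. b n / real n) ` {M..})"
  have bdd: "bdd_below ((\<lambda>n. b n / real n) ` {M..})"
    by (rule bdd_belowI[of _ 0]) (auto simp: b_def)
  have lower: "L \<le> b n / real n" if "M \<le> n" for n
    unfolding L_def using that by (intro cInf_lower bdd) auto
  have "(\<lambda>n. b n / real n) \<longlonglongrightarrow> L"
  proof (rule LIMSEQ_I)
    fix \<epsilon> :: real assume \<epsilon>: "\<epsilon> > 0"
    have "Inf ((\<lambda>n. b n / real n) ` {M..}) < L + \<epsilon> / 2" using \<epsilon> unfolding L_def by simp
    then obtain m where m: "M \<le> m" "b m / real m < L + \<epsilon> / 2"
      using cInf_lessD[of "(\<lambda>n. b n / real n) ` {M..}"] by auto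
    have m0: "m > 0" using m(1) unfolding M_def by simp
    define C where "C = Max (b ` {M..<M + m})"
    have C: "b r \<le> C" if "M \<le> r" "r < M + m" for r
      unfolding C_def using that by (intro Max_ge) auto
    have C0: "0 \<le> C" using C[of M] m0 unfolding b_def by simp
    \<comment> \<open>Large enough that the remainder term \<open>C / n\<close> is below half of the error.\<close>
    define n0 where "n0 = max (M + m) (nat \<lceil>2 * C / \<epsilon>\<rceil> + 1)"
    have "\<bar>b n / real n - L\<bar> < \<epsilon>" if n: "n \<ge> n0" for n
    proof -
      have nM: "M + m \<le> n" using n unfolding n0_def by simp
      have n0: "real n > 0" using nM m0 by simp
      have nC: "2 * C / \<epsilon> < real n" using n unfolding n0_def by linarith
      define q r where "q = (n - M) div m" and "r = (n - M) mod m + M"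
      have qr: "n = q * m + r" using nM unfolding q_def r_def by simp
      have r: "M \<le> r" "r < M + m" unfolding r_def using m0 by simp_all
      have "b n \<le> real q * b m + b r" using bmult[OF m(1) r(1)] qr by simp
      also have "\<dots> \<le> real q * b m + C" using C[OF r] by simp
      also have "real q * b m = real (q * m) * (b m / real m)" using m0 by simp
      also have "\<dots> \<le> real n * (b m / real m)"
        by (rule mult_right_mono) (use qr in \<open>auto simp: b_def simp flip: of_nat_mult\<close>)
      also have "\<dots> \<le> real n * (L + \<epsilon> / 2)" using m(2) by (intro mult_left_mono) auto
      finally have "b n / real n \<le> L + \<epsilon> / 2 + C / real n"
        using n0 by (simp add: field_simps)
      moreover have "C / real n < \<epsilon> / 2" using nC n0 \<epsilon> by (simp add: field_simps)
      moreover have "L \<le> b n / real n" using lower nM by simp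
      ultimately show ?thesis by linarith
    qed
    then show "\<exists>n0. \<forall>n\<ge>n0. norm (b n / real n - L) < \<epsilon>" by auto
  qed
  moreover have "(\<lambda>n. real k / real n) \<longlonglongrightarrow> 0"
    by (rule lim_const_over_n)
  ultimately have "(\<lambda>n. b n / real n - real k / real n) \<longlonglongrightarrow> L - 0"
    by (rule tendsto_diff)
  moreover have "(\<lambda>n. b n / real n - real k / real n) = (\<lambda>n. real (a n) / real n)"
    unfolding b_def by (simp add: diff_divide_distrib[symmetric])
  ultimately show ?thesis by auto
qed

text \<open>
  With the constant \<open>k\<close> below, \<open>w (2 n) / (2 n) - k / (2 n) \<le> wsat K\<^bsub>n,n\<^esub> / (2 n) \<le> w n / n\<close> for all large \<open>n\<close>, and both
  bounds tend to the same limit.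
\<close>

lemma wsat_bipartite_limits:
  assumes H: "bipartite_graph H" "H \<noteq> {}"
  shows "\<exists>L :: real. (\<lambda>n. real (wsat_complete 2 n H) / real n) \<longlonglongrightarrow> L \<and>
         (\<lambda>n. real (wsat (complete_bipartite n n) H) / (2 * real n)) \<longlonglongrightarrow> L"
proof -
  define k where "k = 2 * (2 * card (\<Union>H))\<^sup>2"
  define w b where "w n = wsat_complete 2 n H" and "b n = wsat (complete_bipartite n n) H" for n
  obtain L :: real where L: "(\<lambda>n. real (w n) / real n) \<longlonglongrightarrow> L"
    using almost_subadditive_converges[of "2 * card (\<Union>H)" w] wsat_complete_subadditive[OF H]
    unfolding w_def by blast
  have "(\<lambda>n. real (w (2 * n)) / real (2 * n)) \<longlonglongrightarrow> L"
    using LIMSEQ_subseq_LIMSEQ[OF L, of "\<lambda>n. 2 * n"] by (simp add: comp_def strict_mono_def)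
  moreover have "(\<lambda>n. real k / 2 / real n) \<longlonglongrightarrow> 0" by (rule lim_const_over_n)
  ultimately have low: "(\<lambda>n. real (w (2 * n)) / real (2 * n) - real k / 2 / real n) \<longlonglongrightarrow> L"
    using tendsto_diff by fastforce
  have ev: "\<forall>\<^sub>F n in sequentially. 2 * card (\<Union>H) < n" by (rule eventually_gt_at_top)
  have "(\<lambda>n. real (b n) / (2 * real n)) \<longlonglongrightarrow> L"
  proof (rule tendsto_sandwich[OF _ _ low L])
    show "\<forall>\<^sub>F n in sequentially. real (w (2 * n)) / real (2 * n) - real k / 2 / real n \<le> real (b n) / (2 * real n)"
      using ev
    proof eventually_elim
      case (elim n)
      have "w (2 * n) \<le> b n + k"
        using wsat_complete_double_le[OF H, of n] elim unfolding w_def b_def k_def by simp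
      then have "real (w (2 * n)) \<le> real (b n) + real k" by linarith
      then have "(real (w (2 * n)) - real k) / (2 * real n) \<le> real (b n) / (2 * real n)"
        by (intro divide_right_mono) auto
      then show ?case by (simp add: diff_divide_distrib)
    qed
    show "\<forall>\<^sub>F n in sequentially. real (b n) / (2 * real n) \<le> real (w n) / real n"
      using ev
    proof eventually_elim
      case (elim n)
      have "real (b n) \<le> 2 * real (w n)"
        using wsat_complete_bipartite_le[OF H elim] unfolding w_def b_def by linarith
      then show ?case using elim by (simp add: field_simps)
    qed
  qed
  then show ?thesis using L unfolding w_def b_def by blast
qed

section \<open>Copies of complete partite hypergraphs\<close>

text \<open>
  The complete \<open>d\<close>-partite hypergraph on arbitrary classes \<open>S 1, \<dots>, S d\<close>, in exactly the form of
  \<open>complete_partite\<close>, whose classes are prescribed sets of pairs.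
\<close>

definition transversals :: "nat \<Rightarrow> (nat \<Rightarrow> 'a set) \<Rightarrow> 'a set set" where
  "transversals d S = {e. e \<subseteq> (\<Union>i\<in>{1..d}. S i) \<and> card e = d \<and> (\<forall>i\<in>{1..d}. card (e \<inter> S i) = 1)}"

lemma complete_partite_eq_transversals: "complete_partite d r = transversals d (partite_class r)"
  unfolding complete_partite_def transversals_def by simp

lemma transversals_iff:
  assumes "disjoint_family_on S {1..d}"
  shows "e \<in> transversals d S \<longleftrightarrow> (\<exists>v. (\<forall>i\<in>{1..d}. v i \<in> S i) \<and> e = v ` {1..d})"
proof
  assume e: "e \<in> transversals d S"
  have "\<exists>x. e \<inter> S i = {x}" if "i \<in> {1..d}" for i
    using e that unfolding transversals_def by (simp add: card_1_singleton_iff)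
  then obtain v where v: "\<And>i. i \<in> {1..d} \<Longrightarrow> e \<inter> S i = {v i}" by metis
  have "v i \<in> S i" if "i \<in> {1..d}" for i using v[OF that] by blast
  moreover have "e = (\<Union>i\<in>{1..d}. e \<inter> S i)" using e unfolding transversals_def by blast
  then have "e = v ` {1..d}" using v by auto
  ultimately show "\<exists>v. (\<forall>i\<in>{1..d}. v i \<in> S i) \<and> e = v ` {1..d}" by blast
next
  assume "\<exists>v. (\<forall>i\<in>{1..d}. v i \<in> S i) \<and> e = v ` {1..d}"
  then obtain v where v: "\<And>i. i \<in> {1..d} \<Longrightarrow> v i \<in> S i" and e: "e = v ` {1..d}" by blast
  have disj: "i = j" if "i \<in> {1..d}" "j \<in> {1..d}" "x \<in> S i" "x \<in> S j" for i j x
    using assms that unfolding disjoint_family_on_def by blast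
  have "inj_on v {1..d}" using v disj by (metis inj_onI)
  then have "card e = d" using e by (simp add: card_image)
  moreover have "e \<inter> S i = {v i}" if "i \<in> {1..d}" for i
    using that v disj unfolding e by blast
  ultimately show "e \<in> transversals d S"
    unfolding transversals_def using e v by auto
qed

lemma transversals_image:
  assumes S: "disjoint_family_on S {1..d}" and f: "inj_on f (\<Union>i\<in>{1..d}. S i)"
  shows "disjoint_family_on (\<lambda>i. f ` S i) {1..d}"
    and "(`) f ` transversals d S = transversals d (\<lambda>i. f ` S i)"
proof -
  show disj: "disjoint_family_on (\<lambda>i. f ` S i) {1..d}"
    unfolding disjoint_family_on_def
  proof (intro ballI impI)
    fix m n assume mn: "m \<in> {1..d}" "n \<in> {1..d}" "m \<noteq> n"
    have "f ` S m \<inter> f ` S n = f ` (S m \<inter> S n)"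
      using mn by (intro inj_on_image_Int[OF f, symmetric]) auto
    also have "S m \<inter> S n = {}" using S mn unfolding disjoint_family_on_def by blast
    finally show "f ` S m \<inter> f ` S n = {}" by simp
  qed
  show "(`) f ` transversals d S = transversals d (\<lambda>i. f ` S i)"
  proof (intro subset_antisym subsetI)
    fix e assume "e \<in> (`) f ` transversals d S"
    then obtain v where "\<forall>i\<in>{1..d}. v i \<in> S i" "e = f ` v ` {1..d}"
      using transversals_iff[OF S] by auto
    then show "e \<in> transversals d (\<lambda>i. f ` S i)"
      unfolding transversals_iff[OF disj] by (intro exI[of _ "f \<circ> v"]) (auto simp: image_comp)
  next
    fix e assume "e \<in> transversals d (\<lambda>i. f ` S i)"
    then obtain v where v: "\<forall>i\<in>{1..d}. v i \<in> f ` S i" "e = v ` {1..d}"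
      using transversals_iff[OF disj] by auto
    have "\<forall>i\<in>{1..d}. \<exists>x. x \<in> S i \<and> v i = f x" using v(1) by blast
    then obtain w where w: "\<forall>i\<in>{1..d}. w i \<in> S i \<and> v i = f (w i)"
      by metis
    then have "w ` {1..d} \<in> transversals d S" using transversals_iff[OF S] by blast
    moreover have "e = f ` w ` {1..d}"
      unfolding v(2) image_image by (rule image_cong) (use w in auto)
    ultimately show "e \<in> (`) f ` transversals d S" by (metis image_eqI)
  qed
qed

lemma disjoint_partite_class: "disjoint_family_on (partite_class r) I"
  unfolding disjoint_family_on_def partite_class_def by auto

lemma Union_complete_partite:
  "\<Union>(complete_partite d r) \<subseteq> (\<Union>i\<in>{1..d}. partite_class r i)"
  unfolding complete_partite_def by blast

lemma Union_transversals:
  assumes S: "disjoint_family_on S {1..d}" and ne: "\<And>i. i \<in> {1..d} \<Longrightarrow> S i \<noteq> {}"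
  shows "\<Union>(transversals d S) = (\<Union>i\<in>{1..d}. S i)"
proof (intro subset_antisym subsetI)
  fix x assume "x \<in> (\<Union>i\<in>{1..d}. S i)"
  then obtain j where j: "j \<in> {1..d}" "x \<in> S j" by blast
  have "\<forall>i\<in>{1..d}. \<exists>x. x \<in> S i" using ne by blast
  then obtain v where v: "\<And>i. i \<in> {1..d} \<Longrightarrow> v i \<in> S i" by metis
  have "(v(j := x)) ` {1..d} \<in> transversals d S"
    unfolding transversals_iff[OF S] using v j by (intro exI[of _ "v(j := x)"]) auto
  moreover have "x \<in> (v(j := x)) ` {1..d}" by (rule image_eqI[OF _ j(1)]) simp
  ultimately show "x \<in> \<Union>(transversals d S)" by blast
qed (auto simp: transversals_def)

text \<open>
  This lemma and the next one say that the copies of \<open>complete_partite d r\<close> are exactly the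
  transversal hypergraphs of disjoint classes of sizes \<open>r 1, \<dots>, r d\<close>. They are the only access to
  isomorphism in what follows.
\<close>

lemma isomorphic_complete_partiteI:
  assumes S: "disjoint_family_on S {1..d}"
    and card: "\<And>i. i \<in> {1..d} \<Longrightarrow> finite (S i) \<and> card (S i) = r i"
  shows "isomorphic_hypergraphs (complete_partite d r) (transversals d S)"
proof -
  have "\<exists>g. bij_betw g {..<r i} (S i)" if "i \<in> {1..d}" for i
    using card[OF that] by (metis card_lessThan finite_lessThan finite_same_card_bij)
  then obtain g where g: "\<And>i. i \<in> {1..d} \<Longrightarrow> bij_betw (g i) {..<r i} (S i)" by metis
  define f where "f = (\<lambda>(i, x). g i x)"
  have im: "f ` partite_class r i = S i" if "i \<in> {1..d}" for i
    using g[OF that] unfolding f_def partite_class_def bij_betw_def by force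
  have inj: "inj_on f (\<Union>i\<in>{1..d}. partite_class r i)"
  proof (rule inj_onI, clarify)
    fix i j i' x j' y
    assume ij: "i' \<in> {1..d}" "j' \<in> {1..d}" "(i, x) \<in> partite_class r i'" "(j, y) \<in> partite_class r j'"
      and eq: "f (i, x) = f (j, y)"
    then have *: "i' = i" "j' = j" "x < r i" "y < r j" unfolding partite_class_def by auto
    have "f (i, x) \<in> S i" using im[of i] ij(1,3) *(1) by (metis image_eqI)
    moreover have "f (i, x) \<in> S j" using im[of j] ij(2,4) *(2) eq by (metis image_eqI)
    ultimately have "i = j" using S ij(1,2) *(1,2) by (metis disjoint_family_on_def disjoint_iff)
    then show "i = j \<and> x = y"
      using g[of i] eq ij * unfolding f_def bij_betw_def inj_on_def by auto
  qed
  have "transversals d S = transversals d (\<lambda>i. f ` partite_class r i)"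
    unfolding transversals_def using im by simp
  then have "transversals d S = (\<lambda>e. f ` e) ` complete_partite d r"
    using transversals_image(2)[OF disjoint_partite_class inj] complete_partite_eq_transversals by metis
  moreover have "inj_on f (\<Union>(complete_partite d r))"
    using inj Union_complete_partite by (rule inj_on_subset)
  ultimately show ?thesis unfolding isomorphic_hypergraphs_def by (intro exI[of _ f] conjI)
qed

text \<open>
  Nonempty classes are required because an isomorphism is injective only on vertices that
  lie in an edge.
\<close>

lemma isomorphic_complete_partiteE:
  assumes iso: "isomorphic_hypergraphs (complete_partite d r) K"
    and r: "\<And>i. i \<in> {1..d} \<Longrightarrow> 1 \<le> r i"
  obtains S where "disjoint_family_on S {1..d}" "\<And>i. i \<in> {1..d} \<Longrightarrow> finite (S i) \<and> card (S i) = r i"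
    "K = transversals d S"
proof -
  obtain f where f: "inj_on f (\<Union>(complete_partite d r))" "K = (\<lambda>e. f ` e) ` complete_partite d r"
    using iso unfolding isomorphic_hypergraphs_def by (elim exE conjE) (rule that)
  have ne: "partite_class r i \<noteq> {}" if "i \<in> {1..d}" for i
    using r[OF that] unfolding partite_class_def by (auto simp: lessThan_empty_iff)
  have "\<Union>(complete_partite d r) = (\<Union>i\<in>{1..d}. partite_class r i)"
    using Union_transversals[OF disjoint_partite_class ne] complete_partite_eq_transversals by metis
  then have inj: "inj_on f (\<Union>i\<in>{1..d}. partite_class r i)" using f(1) by simp
  show ?thesis
  proof (rule that)
    show "disjoint_family_on (\<lambda>i. f ` partite_class r i) {1..d}"
      by (rule transversals_image(1)[OF disjoint_partite_class inj])
    show "K = transversals d (\<lambda>i. f ` partite_class r i)"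
      using transversals_image(2)[OF disjoint_partite_class inj] complete_partite_eq_transversals f(2) by metis
    fix i assume i: "i \<in> {1..d}"
    have "inj_on f (partite_class r i)" using inj i by (meson UN_upper inj_on_subset)
    then have "card (f ` partite_class r i) = card (partite_class r i)" by (rule card_image)
    then show "finite (f ` partite_class r i) \<and> card (f ` partite_class r i) = r i"
      unfolding partite_class_def by (simp add: card_cartesian_product)
  qed
qed

lemma disjoint_subsets_with_cards:
  assumes "finite I" "finite Z" "(\<Sum>i\<in>I. k i) \<le> card Z"
  shows "\<exists>D. disjoint_family_on D I \<and> (\<forall>i\<in>I. D i \<subseteq> Z \<and> card (D i) = k i)"
  using assms
proof (induction I arbitrary: Z)
  case (insert j I)
  have sum: "k j + (\<Sum>i\<in>I. k i) \<le> card Z" using insert.prems(2) insert.hyps by simp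
  then have "k j \<le> card Z" by simp
  then obtain Y where Y: "Y \<subseteq> Z" "card Y = k j" by (meson obtain_subset_with_card_n)
  have "finite Y" using Y insert.prems(1) finite_subset by blast
  then have "(\<Sum>i\<in>I. k i) \<le> card (Z - Y)"
    using Y sum by (simp add: card_Diff_subset)
  then obtain D where D: "disjoint_family_on D I" "\<forall>i\<in>I. D i \<subseteq> Z - Y \<and> card (D i) = k i"
    using insert.IH[of "Z - Y"] insert.prems(1) by blast
  have disj: "disjoint_family_on (D(j := Y)) (insert j I)"
    unfolding disjoint_family_on_def
  proof (intro ballI impI)
    fix a b assume ab: "a \<in> insert j I" "b \<in> insert j I" "a \<noteq> b"
    have "D a \<inter> D b = {}" if "a \<in> I" "b \<in> I"
      using D(1) ab(3) that unfolding disjoint_family_on_def by blast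
    moreover have "D i \<inter> Y = {}" if "i \<in> I" for i using D(2) that by blast
    ultimately show "(D(j := Y)) a \<inter> (D(j := Y)) b = {}"
      using ab by (cases "a = j"; cases "b = j") (simp_all add: Int_commute)
  qed
  then show ?case
    using D Y insert.hyps(2) by (intro exI[of _ "D(j := Y)"] conjI disj) auto
qed (simp add: disjoint_family_on_def)

lemma complete_hypergraphI: "e \<subseteq> {..<n} \<Longrightarrow> card e = q \<Longrightarrow> e \<in> complete_hypergraph q n"
  unfolding complete_hypergraph_def by simp

lemma card_ge_2I: "finite A \<Longrightarrow> x \<in> A \<Longrightarrow> y \<in> A \<Longrightarrow> x \<noteq> y \<Longrightarrow> 2 \<le> card A"
  using card_mono[of A "{x, y}"] by simp

lemma card_complete_hypergraph: "card (complete_hypergraph q n) = n choose q"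
  unfolding complete_hypergraph_def using n_subsets[of "{..<n}" q] by simp

section \<open>The upper bound for complete partite hypergraphs\<close>

text \<open>
  The core \<open>C\<close> has as many vertices as the copy of \<open>H\<close>, so the classes of a new copy can always be
  filled up with core vertices. An edge meeting \<open>C\<close> only in \<open>x\<close> is completed by a copy whose first class is \<open>A \<union> {x}\<close>, while
  each other class consists of one vertex of the edge and otherwise of core vertices: any other edge of
  this copy has two vertices in \<open>C\<close> or meets \<open>C\<close> only in a vertex of \<open>A\<close>. An edge avoiding \<open>C\<close> is completed by a copy each of whose
  classes is one of its vertices and core vertices, since every other edge of that copy meets \<open>C\<close>.
\<close>

lemma wsat_complete_partite_upper:
  assumes d: "2 \<le> d" and r: "\<And>i. i \<in> {1..d} \<Longrightarrow> 1 \<le> r i" and n: "(\<Sum>i\<in>{1..d}. r i) \<le> n"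
  shows "wsat_complete d n (complete_partite d r)
    \<le> (r 1 - 1) * (n choose (d - 1)) + (\<Sum>i\<in>{1..d}. r i)\<^sup>2 * (n choose (d - 2))"
proof -
  define c where "c = (\<Sum>i\<in>{1..d}. r i)"
  define C where "C = {..<c}"
  define A where "A = {..<r 1 - 1}"
  define I where "I = {2..d}"
  have I: "{1..d} = insert 1 I" "1 \<notin> I" "finite I" using d unfolding I_def by auto
  have sumc: "c = r 1 + (\<Sum>i\<in>I. r i)" unfolding c_def I(1) using I(2,3) by simp
  let ?F = "complete_hypergraph d n"
  define G1 G2 where "G1 = {e \<in> ?F. 2 \<le> card (e \<inter> C)}" and "G2 = {e \<in> ?F. \<exists>x\<in>A. e \<inter> C = {x}}"
  have AC: "A \<subseteq> C" using sumc unfolding A_def C_def by auto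
  have Cn: "C \<subseteq> {..<n}" using n unfolding C_def c_def by auto
  have finC: "finite C" unfolding C_def by simp
  have "weakly_saturated (complete_partite d r) ?F (G1 \<union> G2)"
  proof (rule weakly_saturatedI)
    show "G1 \<union> G2 \<subseteq> ?F" unfolding G1_def G2_def by blast
  next
    fix X assume X: "copy_closed (complete_partite d r) ?F X" and GX: "G1 \<union> G2 \<subseteq> X"
    have many: "e \<in> X" if "e \<in> ?F" "x \<in> e \<inter> C" "y \<in> e \<inter> C" "x \<noteq> y" for e x y
    proof -
      have "2 \<le> card (e \<inter> C)" by (rule card_ge_2I[OF _ that(2-4)]) (simp add: finC)
      then show ?thesis using that(1) GX unfolding G1_def by blast
    qed
    have extend: "v ` {1..d} \<in> X"
      if S: "disjoint_family_on S {1..d}" and card: "\<And>i. i \<in> {1..d} \<Longrightarrow> card (S i) = r i"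
        and sub: "\<And>i. i \<in> {1..d} \<Longrightarrow> S i \<subseteq> {..<n}"
        and v: "\<And>i. i \<in> {1..d} \<Longrightarrow> v i \<in> S i"
        and others: "\<And>w. (\<And>i. i \<in> {1..d} \<Longrightarrow> w i \<in> S i) \<Longrightarrow> w ` {1..d} \<in> ?F \<Longrightarrow>
            w ` {1..d} \<noteq> v ` {1..d} \<Longrightarrow> w ` {1..d} \<in> X" for S v
    proof -
      have sF: "e \<in> ?F" if "e \<in> transversals d S" for e
        using that sub unfolding transversals_def complete_hypergraph_def by blast
      have "isomorphic_hypergraphs (complete_partite d r) (transversals d S)"
        by (intro isomorphic_complete_partiteI[OF S] conjI card finite_subset[OF sub]) auto
      moreover have vS: "v ` {1..d} \<in> transversals d S" using v transversals_iff[OF S] by blast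
      moreover have "e \<in> X" if "e \<in> transversals d S" "e \<noteq> v ` {1..d}" for e
        using others sF[OF that(1)] that unfolding transversals_iff[OF S] by blast
      then have "transversals d S \<subseteq> insert (v ` {1..d}) X" by blast
      ultimately show ?thesis using X sF[OF vS] unfolding copy_closed_def by blast
    qed
    have one: "e \<in> X" if e: "e \<in> ?F" "e \<inter> C = {x}" for e x
    proof (cases "x \<in> A")
      case True
      then show ?thesis using e GX unfolding G2_def by blast
    next
      case False
      have xe: "x \<in> e" "x \<in> C" using e(2) by blast+
      have fe: "finite e" "card e = d" "e \<subseteq> {..<n}"
        using e(1) finite_subset unfolding complete_hypergraph_def by auto
      have "card (e - {x}) = card I" using fe xe unfolding I_def by simp
      then obtain t where t: "bij_betw t I (e - {x})"
        using I(3) fe(1) by (metis finite_Diff finite_same_card_bij)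
      define v where "v = t(1 := x)"
      have tI: "t ` I = e - {x}" using t unfolding bij_betw_def by blast
      have vI: "v i = t i" "v i \<in> e" "v i \<notin> C" if "i \<in> I" for i
      proof -
        show "v i = t i" using that I(2) unfolding v_def by auto
        then have "v i \<in> e - {x}" using that tI by blast
        then show "v i \<in> e" "v i \<notin> C" using e(2) by blast+
      qed
      have v1: "v 1 = x" unfolding v_def by simp
      have ve: "v ` {1..d} = e" unfolding I(1) using vI(1) tI xe v1 by force
      have "(\<Sum>i\<in>I. r i - 1) \<le> (\<Sum>i\<in>I. r i)" by (intro sum_mono) simp
      also have "\<dots> \<le> card (C - insert x A)"
      proof -
        have "card (insert x A) \<le> r 1" using r[of 1] d unfolding A_def by (simp add: card_insert_if)
        then show ?thesis using sumc AC xe by (simp add: card_Diff_subset A_def C_def)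
      qed
      finally obtain D where D: "disjoint_family_on D I"
        "\<And>i. i \<in> I \<Longrightarrow> D i \<subseteq> C - insert x A \<and> card (D i) = r i - 1"
        using disjoint_subsets_with_cards[OF I(3), of "C - insert x A" "\<lambda>i. r i - 1"] finC by blast
      define S where "S i = (if i = 1 then insert x A else insert (v i) (D i))" for i
      have S1: "S 1 = insert x A" unfolding S_def by simp
      have SI: "S i = insert (v i) (D i)" if "i \<in> I" for i using that I(2) unfolding S_def by auto
      have "v ` {1..d} \<in> X"
      proof (rule extend[of S])
        show "v i \<in> S i" if "i \<in> {1..d}" for i
          using that SI[of i] S1 v1 unfolding I(1) by blast
        show "S i \<subseteq> {..<n}" if "i \<in> {1..d}" for i
        proof (cases "i = 1")
          case True
          show ?thesis unfolding True S1 using AC xe Cn by blast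
        next
          case False
          then have i: "i \<in> I" using that I(1) by blast
          show ?thesis unfolding SI[OF i] using D(2)[OF i] vI(2)[OF i] fe(3) Cn by blast
        qed
        show "card (S i) = r i" if "i \<in> {1..d}" for i
        proof (cases "i = 1")
          case True
          then show ?thesis using S1 False r[OF that] unfolding A_def by simp
        next
          case False
          then have i: "i \<in> I" using that I(1) by blast
          have "v i \<notin> D i" using D(2)[OF i] vI(3)[OF i] by blast
          moreover have "finite (D i)" using D(2)[OF i] finC by (meson finite_Diff finite_subset)
          ultimately          show ?thesis using SI[OF i] D(2)[OF i] r[OF that] by simp
        qed
        have tinj: "v i \<noteq> v j" if "i \<in> I" "j \<in> I" "i \<noteq> j" for i j
          using t that vI(1) unfolding bij_betw_def inj_on_def by metis
        have "S i \<inter> S j = {}" if "i \<in> I" "j \<in> I" "i \<noteq> j" for i j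
        proof -
          have "D i \<inter> D j = {}" using D(1) that unfolding disjoint_family_on_def by blast
          then show ?thesis unfolding SI[OF that(1)] SI[OF that(2)]
            using tinj[OF that] D(2)[OF that(1)] D(2)[OF that(2)] vI(3)[OF that(1)] vI(3)[OF that(2)]
            by blast
        qed
        moreover have "S 1 \<inter> S j = {}" if "j \<in> I" for j
          unfolding SI[OF that] S1 using D(2)[OF that] vI(3)[OF that] AC xe by blast
        ultimately show "disjoint_family_on S {1..d}"
          unfolding disjoint_family_on_def I(1) by (metis inf_commute insert_iff)
        fix w assume w: "\<And>i. i \<in> {1..d} \<Longrightarrow> w i \<in> S i" and wF: "w ` {1..d} \<in> ?F"
          and wv: "w ` {1..d} \<noteq> v ` {1..d}"
        have w1: "w 1 \<in> insert x A" using w[of 1] S1 I(1) by blast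
        show "w ` {1..d} \<in> X"
        proof (cases "\<exists>i\<in>I. w i \<in> D i")
          case True
          then obtain i where i: "i \<in> I" "w i \<in> D i" by blast
          show ?thesis
          proof (rule many[OF wF])
            have "w i \<in> C - insert x A" using i D(2)[OF i(1)] by blast
            then show "w i \<in> w ` {1..d} \<inter> C" "w 1 \<noteq> w i" using w1 i(1) unfolding I(1) by auto
            show "w 1 \<in> w ` {1..d} \<inter> C" using w1 AC xe(2) unfolding I(1) by auto
          qed
        next
          case False
          then have wI: "w i = v i" if "i \<in> I" for i using that w[of i] SI[OF that] I(1) by blast
          then have "w 1 \<noteq> x" using wv v1 I(1) by (metis (no_types, lifting) image_cong insert_iff)
          then have wA: "w 1 \<in> A" using w1 by blast
          have "w ` I = v ` I" using wI by simp
          then have "w ` {1..d} = insert (w 1) (v ` I)" unfolding I(1) by simp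
          moreover have "v ` I \<inter> C = {}" using vI(3) by auto
          ultimately have "w ` {1..d} \<inter> C = {w 1}" using wA AC by auto
          then show ?thesis using wA wF GX unfolding G2_def by blast
        qed
      qed
      then show ?thesis using ve by simp
    qed
    have none: "e \<in> X" if e: "e \<in> ?F" "e \<inter> C = {}" for e
    proof -
      have fe: "finite e" "card e = d" "e \<subseteq> {..<n}"
        using e(1) finite_subset unfolding complete_hypergraph_def by auto
      then obtain v where v: "bij_betw v {1..d} e"
        by (metis card_atLeastAtMost diff_Suc_1 finite_atLeastAtMost finite_same_card_bij)
      have ve: "v ` {1..d} = e" using v unfolding bij_betw_def by blast
      have vC: "v i \<in> e" "v i \<notin> C" if "i \<in> {1..d}" for i using that ve e(2) by blast+
      have "(\<Sum>i\<in>{1..d}. r i - 1) \<le> card C" unfolding C_def c_def by (simp add: sum_mono)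
      then obtain D where D: "disjoint_family_on D {1..d}"
        "\<And>i. i \<in> {1..d} \<Longrightarrow> D i \<subseteq> C \<and> card (D i) = r i - 1"
        using disjoint_subsets_with_cards[of "{1..d}" C "\<lambda>i. r i - 1"] finC by blast
      have "v ` {1..d} \<in> X"
      proof (rule extend[of "\<lambda>i. insert (v i) (D i)"])
        show "insert (v i) (D i) \<subseteq> {..<n}" if "i \<in> {1..d}" for i
          using D(2)[OF that] vC(1)[OF that] fe(3) Cn by blast
        show "card (insert (v i) (D i)) = r i" if i: "i \<in> {1..d}" for i
        proof -
          have "v i \<notin> D i" using D(2)[OF i] vC(2)[OF i] by blast
          moreover have "finite (D i)" using D(2)[OF i] finC by (meson finite_subset)
          ultimately show ?thesis using D(2)[OF i] r[OF i] by simp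
        qed
        have "insert (v i) (D i) \<inter> insert (v j) (D j) = {}"
          if "i \<in> {1..d}" "j \<in> {1..d}" "i \<noteq> j" for i j
        proof -
          have "v i \<noteq> v j" using v that unfolding bij_betw_def inj_on_def by blast
          moreover have "D i \<inter> D j = {}" using D(1) that unfolding disjoint_family_on_def by blast
          ultimately show ?thesis using that D(2) vC(2) by blast
        qed
        then show "disjoint_family_on (\<lambda>i. insert (v i) (D i)) {1..d}"
          unfolding disjoint_family_on_def by blast
        fix w assume w: "\<And>i. i \<in> {1..d} \<Longrightarrow> w i \<in> insert (v i) (D i)" and wF: "w ` {1..d} \<in> ?F"
          and wv: "w ` {1..d} \<noteq> v ` {1..d}"
        have "\<exists>i\<in>{1..d}. w i \<noteq> v i" using wv by (meson image_cong)
        then obtain i where i: "i \<in> {1..d}" "w i \<in> D i" using w by blast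
        then have wi: "w i \<in> w ` {1..d} \<inter> C" using D(2) by blast
        show "w ` {1..d} \<in> X"
        proof (cases "\<exists>y \<in> w ` {1..d} \<inter> C. y \<noteq> w i")
          case True
          then show ?thesis using many[OF wF] wi by blast
        next
          case False
          then have "w ` {1..d} \<inter> C = {w i}" using wi by blast
          then show ?thesis using one[OF wF] by blast
        qed
      qed auto
      then show ?thesis using ve by simp
    qed
    show "?F \<subseteq> X"
    proof
      fix e assume e: "e \<in> ?F"
      consider "e \<inter> C = {}" | x where "e \<inter> C = {x}" | x y where "x \<in> e \<inter> C" "y \<in> e \<inter> C" "x \<noteq> y"
        by blast
      then show "e \<in> X" using none[OF e] one[OF e] many[OF e] by cases blast+
    qed
  qed (rule finite_complete_hypergraph)
  then have "wsat_complete d n (complete_partite d r) \<le> card (G1 \<union> G2)"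
    unfolding wsat_complete_def by (rule wsat_le)
  also have "\<dots> \<le> card G2 + card G1" by (metis add.commute card_Un_le)
  also have "card G2 \<le> (r 1 - 1) * (n choose (d - 1))"
  proof -
    let ?P = "A \<times> complete_hypergraph (d - 1) n"
    have "G2 \<subseteq> (\<lambda>(x, T). insert x T) ` ?P"
    proof
      fix e assume "e \<in> G2"
      then obtain x where x: "x \<in> A" "x \<in> e" and e: "e \<subseteq> {..<n}" "card e = d"
        unfolding G2_def complete_hypergraph_def by auto
      have "e - {x} \<in> complete_hypergraph (d - 1) n"
        using x e by (intro complete_hypergraphI) auto
      then show "e \<in> (\<lambda>(x, T). insert x T) ` ?P"
        using x by (intro image_eqI[of _ _ "(x, e - {x})"]) auto
    qed
    then have "card G2 \<le> card ?P"
      by (rule surj_card_le[rotated]) (simp add: A_def finite_complete_hypergraph)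
    then show ?thesis by (simp add: card_cartesian_product card_complete_hypergraph A_def)
  qed
  also have "card G1 \<le> c\<^sup>2 * (n choose (d - 2))"
  proof -
    let ?P = "(C \<times> C) \<times> complete_hypergraph (d - 2) n"
    have "G1 \<subseteq> (\<lambda>((x, y), T). insert x (insert y T)) ` ?P"
    proof
      fix e assume eG: "e \<in> G1"
      then have e: "e \<subseteq> {..<n}" "card e = d" and two: "2 \<le> card (e \<inter> C)"
        unfolding G1_def complete_hypergraph_def by auto
      obtain Y where "Y \<subseteq> e \<inter> C" "card Y = 2" using two by (meson obtain_subset_with_card_n)
      then obtain x y where xy: "x \<in> e \<inter> C" "y \<in> e \<inter> C" "x \<noteq> y" by (auto simp: card_2_iff)
      have "card (e - {x, y}) = d - 2" using xy e(2) by (subst card_Diff_subset) auto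
      then have "e - {x, y} \<in> complete_hypergraph (d - 2) n"
        using e(1) by (intro complete_hypergraphI) auto
      then show "e \<in> (\<lambda>((x, y), T). insert x (insert y T)) ` ?P"
        using xy by (intro image_eqI[of _ _ "((x, y), e - {x, y})"]) auto
    qed
    then have "card G1 \<le> card ?P"
      by (rule surj_card_le[rotated]) (simp add: C_def finite_complete_hypergraph)
    then show ?thesis
      by (simp add: card_cartesian_product card_complete_hypergraph C_def power2_eq_square)
  qed
  finally show ?thesis unfolding c_def by simp
qed

section \<open>Linear systems and moments\<close>

text \<open>
  Gaussian elimination: if some unknown \<open>i0\<close> occurs in the equation \<open>d\<close>, it is eliminated from the other
  equations and recovered at the end.
\<close>

lemma underdetermined_system:
  fixes m :: "'i \<Rightarrow> 'd \<Rightarrow> real"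
  assumes "finite D" "finite I" "card D < card I"
  shows "\<exists>x. (\<exists>i\<in>I. x i \<noteq> 0) \<and> (\<forall>d\<in>D. (\<Sum>i\<in>I. x i * m i d) = 0)"
  using assms
proof (induction D arbitrary: I m)
  case empty
  then have "I \<noteq> {}" by auto
  then show ?case by (intro exI[of _ "\<lambda>_. 1"]) auto
next
  case (insert d D)
  have cD: "Suc (card D) < card I" using insert.prems(2) insert.hyps by simp
  show ?case
  proof (cases "\<forall>i\<in>I. m i d = 0")
    case True
    obtain x where x: "\<exists>i\<in>I. x i \<noteq> 0" "\<forall>d\<in>D. (\<Sum>i\<in>I. x i * m i d) = 0"
      using insert.IH[OF insert.prems(1), of m] cD by auto
    have "(\<Sum>i\<in>I. x i * m i d) = 0" using True by simp
    then show ?thesis using x by (intro exI[of _ x]) auto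
  next
    case False
    then obtain i0 where i0: "i0 \<in> I" "m i0 d \<noteq> 0" by blast
    define I' where "I' = I - {i0}"
    have I': "finite I'" "card D < card I'" "i0 \<notin> I'" "I = insert i0 I'"
      using i0 insert.prems(1) cD unfolding I'_def by auto
    obtain x where x: "\<exists>i\<in>I'. x i \<noteq> 0"
      and eq: "\<And>d'. d' \<in> D \<Longrightarrow> (\<Sum>i\<in>I'. x i * (m i d' - m i d / m i0 d * m i0 d')) = 0"
      using insert.IH[OF I'(1,2), of "\<lambda>i d'. m i d' - m i d / m i0 d * m i0 d'"] by blast
    define s where "s = - (\<Sum>i\<in>I'. x i * m i d) / m i0 d"
    define y where "y = x(i0 := s)"
    have y: "(\<Sum>i\<in>I. y i * m i e) = s * m i0 e + (\<Sum>i\<in>I'. x i * m i e)" for e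
    proof -
      have "(\<Sum>i\<in>I'. y i * m i e) = (\<Sum>i\<in>I'. x i * m i e)"
        using I'(3) unfolding y_def by (intro sum.cong) auto
      then show ?thesis unfolding I'(4) using I'(1,3) by (simp add: y_def)
    qed
    have "(\<Sum>i\<in>I. y i * m i d) = 0" unfolding y s_def using i0 by simp
    moreover have "(\<Sum>i\<in>I. y i * m i d') = 0" if "d' \<in> D" for d'
    proof -
      have "(\<Sum>i\<in>I'. x i * (m i d' - m i d / m i0 d * m i0 d'))
          = (\<Sum>i\<in>I'. x i * m i d') - (\<Sum>i\<in>I'. x i * m i d) * (m i0 d' / m i0 d)"
        unfolding sum_distrib_right sum_subtractf[symmetric] by (intro sum.cong) (auto simp: algebra_simps)
      then show ?thesis using eq[OF that] unfolding y s_def by (simp add: field_simps)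
    qed
    moreover have "\<exists>i\<in>I. y i \<noteq> 0"
      using x I'(3,4) unfolding y_def by (metis fun_upd_other insertCI)
    ultimately show ?thesis by (intro exI[of _ y]) auto
  qed
qed

text \<open>
  The Vandermonde determinant in disguise: the hypothesis says that \<open>f\<close> annihilates all polynomials of degree
  below \<open>m\<close>, among them \<open>\<Prod>y\<in>P - {x}. (z - y)\<close>, which vanishes on \<open>P\<close> except at \<open>x\<close>.
\<close>

lemma vanishing_moments:
  fixes f :: "nat \<Rightarrow> real"
  assumes P: "finite P" "card P \<le> m"
    and mom: "\<And>k. k < m \<Longrightarrow> (\<Sum>x\<in>P. f x * real x ^ k) = 0"
    and x: "x \<in> P"
  shows "f x = 0"
proof -
  \<comment> \<open>The product is expanded one factor at a time, at the price of one moment per factor.\<close>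
  have newton: "finite Y \<Longrightarrow> k + card Y < m \<Longrightarrow> (\<Sum>x\<in>P. f x * real x ^ k * (\<Prod>y\<in>Y. real x - real y)) = 0" for Y k
  proof (induction Y arbitrary: k rule: finite_induct)
    case empty
    then show ?case using mom by simp
  next
    case (insert y Y)
    have "(\<Sum>x\<in>P. f x * real x ^ k * (\<Prod>y\<in>insert y Y. real x - real y))
      = (\<Sum>x\<in>P. f x * real x ^ Suc k * (\<Prod>y\<in>Y. real x - real y))
        - real y * (\<Sum>x\<in>P. f x * real x ^ k * (\<Prod>y\<in>Y. real x - real y))"
      unfolding sum_distrib_left sum_subtractf[symmetric] using insert.hyps
      by (intro sum.cong) (auto simp: algebra_simps)
    also have "\<dots> = 0" using insert.IH[of k] insert.IH[of "Suc k"] insert.prems insert.hyps by simp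
    finally show ?case .
  qed
  have "card (P - {x}) < m"
    using card_Diff1_less[OF P(1) x] P(2) by simp
  then have "(\<Sum>z\<in>P. f z * (\<Prod>y\<in>P - {x}. real z - real y)) = 0"
    using newton[of "P - {x}" 0] P(1) by simp
  moreover have "(\<Sum>z\<in>P. f z * (\<Prod>y\<in>P - {x}. real z - real y))
      = (\<Sum>z\<in>{x}. f z * (\<Prod>y\<in>P - {x}. real z - real y))"
    using P(1) x by (intro sum.mono_neutral_right) auto
  moreover have "(\<Prod>y\<in>P - {x}. real x - real y) \<noteq> 0"
    using P(1) by simp
  ultimately show ?thesis by simp
qed

text \<open>
  There are more unknowns than equations, so a nonzero solution on \<open>S\<close> exists. If it vanished at some point of \<open>S\<close>,
  it would live on \<open>s - 1\<close> points and have \<open>s - 1\<close> vanishing moments, so it would vanish altogether.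
\<close>

lemma moment_relation_exists:
  assumes S: "finite S" "card S = s" "1 \<le> s"
  shows "\<exists>a :: nat \<Rightarrow> real. (\<forall>x. a x \<noteq> 0 \<longleftrightarrow> x \<in> S) \<and> (\<forall>k<s - 1. (\<Sum>x\<in>S. a x * real x ^ k) = 0)"
proof -
  have "card {..<s - 1} < card S" using S by simp
  then obtain a where a: "\<exists>x\<in>S. a x \<noteq> 0" and mom: "\<forall>k\<in>{..<s - 1}. (\<Sum>x\<in>S. a x * real x ^ k) = 0"
    using underdetermined_system[of "{..<s - 1}" S "\<lambda>x k. real x ^ k"] S(1) by auto
  have "a x \<noteq> 0" if x: "x \<in> S" for x
  proof
    assume ax: "a x = 0"
    have sum: "(\<Sum>z\<in>S - {x}. a z * real z ^ k) = 0" if "k < s - 1" for k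
    proof -
      have "(\<Sum>z\<in>S. a z * real z ^ k) = (\<Sum>z\<in>S - {x}. a z * real z ^ k)"
        using S(1) ax x by (intro sum.mono_neutral_right) auto
      then show ?thesis using mom that by simp
    qed
    have "a z = 0" if "z \<in> S - {x}" for z
      by (rule vanishing_moments[OF _ _ sum that]) (use S x in auto)
    then show False using a ax by blast
  qed
  then show ?thesis
    by (intro exI[of _ "\<lambda>x. if x \<in> S then a x else 0"]) (use mom in auto)
qed

section \<open>Alternating functions and the lower bound\<close>

text \<open>
  The wedge product of the functions \<open>a i\<close>, as the determinant of the matrix with entries \<open>a i (v j)\<close>. A set of
  \<open>card I\<close> vertices determines its value only up to sign, which is why values are taken at
  tuples \<open>v\<close> rather than at edges.
\<close>

definition alternating_product :: "'i set \<Rightarrow> ('i \<Rightarrow> 'v \<Rightarrow> real) \<Rightarrow> ('i \<Rightarrow> 'v) \<Rightarrow> real" where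
  "alternating_product I a v = (\<Sum>\<pi> | \<pi> permutes I. of_int (sign \<pi>) * (\<Prod>i\<in>I. a i (v (\<pi> i))))"

text \<open>
  The elements of the exterior power indexed by \<open>I\<close> of the space of functions on \<open>V\<close> whose first \<open>m\<close> moments vanish: alternating
  functions that lie in that space in each argument. Tuples are total functions on the index type, so the second
  clause states that only the values on \<open>I\<close> matter.
\<close>

definition alternating_relation :: "'i set \<Rightarrow> nat set \<Rightarrow> nat \<Rightarrow> (('i \<Rightarrow> nat) \<Rightarrow> real) \<Rightarrow> bool" where
  "alternating_relation I V m h \<longleftrightarrow>
     (\<forall>v \<tau>. \<tau> permutes I \<longrightarrow> h (v \<circ> \<tau>) = of_int (sign \<tau>) * h v) \<and>
     (\<forall>v w. (\<forall>i\<in>I. v i = w i) \<longrightarrow> h v = h w) \<and>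
     (\<forall>v. \<forall>j\<in>I. \<forall>k<m. (\<Sum>x\<in>V. h (v(j := x)) * real x ^ k) = 0)"

lemma alternating_product_relation:
  fixes a :: "'i \<Rightarrow> nat \<Rightarrow> real"
  assumes I: "finite I" and mom: "\<And>i k. i \<in> I \<Longrightarrow> k < m \<Longrightarrow> (\<Sum>x\<in>V. a i x * real x ^ k) = 0"
  shows "alternating_relation I V m (alternating_product I a)"
  unfolding alternating_relation_def
proof (intro conjI allI impI ballI)
  fix v :: "'i \<Rightarrow> nat" and \<tau> assume \<tau>: "\<tau> permutes I"
  have "alternating_product I a (v \<circ> \<tau>)
      = (\<Sum>\<pi> | \<pi> permutes I. of_int (sign \<tau>) * (of_int (sign (\<tau> \<circ> \<pi>)) * (\<Prod>i\<in>I. a i (v ((\<tau> \<circ> \<pi>) i)))))"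
    unfolding alternating_product_def
  proof (rule sum.cong[OF refl])
    fix \<pi> assume "\<pi> \<in> {\<pi>. \<pi> permutes I}"
    then have "permutation \<pi>" "permutation \<tau>" using I \<tau> by (auto intro: permutes_imp_permutation)
    then have "sign \<pi> = sign \<tau> * sign (\<tau> \<circ> \<pi>)" by (simp add: sign_compose)
    then have "of_int (sign \<pi>) = (of_int (sign \<tau>) * of_int (sign (\<tau> \<circ> \<pi>)) :: real)"
      by (metis of_int_mult)
    then show "of_int (sign \<pi>) * (\<Prod>i\<in>I. a i ((v \<circ> \<tau>) (\<pi> i)))
      = of_int (sign \<tau>) * (of_int (sign (\<tau> \<circ> \<pi>)) * (\<Prod>i\<in>I. a i (v ((\<tau> \<circ> \<pi>) i))))"
      by simp
  qed
  also have "\<dots> = (\<Sum>\<pi> | \<pi> permutes I. of_int (sign \<tau>) * (of_int (sign \<pi>) * (\<Prod>i\<in>I. a i (v (\<pi> i)))))"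
    by (rule setum_permutations_compose_left[OF \<tau>, symmetric])
  finally show "alternating_product I a (v \<circ> \<tau>) = of_int (sign \<tau>) * alternating_product I a v"
    unfolding alternating_product_def sum_distrib_left .
next
  fix v w :: "'i \<Rightarrow> nat" assume vw: "\<forall>i\<in>I. v i = w i"
  have "a i (v (\<pi> i)) = a i (w (\<pi> i))" if "\<pi> permutes I" "i \<in> I" for \<pi> i
    using vw permutes_in_image[OF that(1), of i] that(2) by simp
  then have "(\<Prod>i\<in>I. a i (v (\<pi> i))) = (\<Prod>i\<in>I. a i (w (\<pi> i)))" if "\<pi> permutes I" for \<pi>
    using that by (intro prod.cong refl)
  then show "alternating_product I a v = alternating_product I a w"
    unfolding alternating_product_def by simp
next
  fix v :: "'i \<Rightarrow> nat" and j k assume j: "j \<in> I" and k: "k < m"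
  have "(\<Sum>x\<in>V. of_int (sign \<pi>) * (\<Prod>i\<in>I. a i ((v(j := x)) (\<pi> i))) * real x ^ k) = 0"
    if \<pi>: "\<pi> permutes I" for \<pi>
  proof -
    have "j \<in> \<pi> ` I" using permutes_image[OF \<pi>] j by simp
    then obtain i0 where i0: "i0 \<in> I" "\<pi> i0 = j" by auto
    have ne: "\<pi> i \<noteq> j" if "i \<in> I - {i0}" for i
      using injD[OF permutes_inj[OF \<pi>], of i i0] i0 that by auto
    have "(\<Prod>i\<in>I. a i ((v(j := x)) (\<pi> i))) = a i0 x * (\<Prod>i\<in>I - {i0}. a i (v (\<pi> i)))" for x
    proof -
      have "(\<Prod>i\<in>I - {i0}. a i ((v(j := x)) (\<pi> i))) = (\<Prod>i\<in>I - {i0}. a i (v (\<pi> i)))"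
        using ne by (intro prod.cong) auto
      then show ?thesis using prod.remove[OF I i0(1), of "\<lambda>i. a i ((v(j := x)) (\<pi> i))"] i0(2) by simp
    qed
    then have "(\<Sum>x\<in>V. of_int (sign \<pi>) * (\<Prod>i\<in>I. a i ((v(j := x)) (\<pi> i))) * real x ^ k)
      = of_int (sign \<pi>) * (\<Prod>i\<in>I - {i0}. a i (v (\<pi> i))) * (\<Sum>x\<in>V. a i0 x * real x ^ k)"
      unfolding sum_distrib_left by (intro sum.cong) (auto simp: mult_ac)
    then show ?thesis using mom[OF i0(1) k] by simp
  qed
  then have "(\<Sum>\<pi> | \<pi> permutes I. \<Sum>x\<in>V. of_int (sign \<pi>) * (\<Prod>i\<in>I. a i ((v(j := x)) (\<pi> i))) * real x ^ k) = 0"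
    by (intro sum.neutral) auto
  then show "(\<Sum>x\<in>V. alternating_product I a (v(j := x)) * real x ^ k) = 0"
    unfolding alternating_product_def sum_distrib_right by (subst sum.swap)
qed

lemma alternating_relation_sum:
  fixes I :: "'i set"
  assumes "\<And>t. t \<in> T \<Longrightarrow> alternating_relation I V m (h t)"
  shows "alternating_relation I V m (\<lambda>v. \<Sum>t\<in>T. x t * h t v)"
  unfolding alternating_relation_def
proof (intro conjI allI impI ballI)
  fix v :: "'i \<Rightarrow> nat" and \<tau> assume "\<tau> permutes I"
  then have "h t (v \<circ> \<tau>) = of_int (sign \<tau>) * h t v" if "t \<in> T" for t
    using assms[OF that] unfolding alternating_relation_def by blast
  then show "(\<Sum>t\<in>T. x t * h t (v \<circ> \<tau>)) = of_int (sign \<tau>) * (\<Sum>t\<in>T. x t * h t v)"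
    unfolding sum_distrib_left by (intro sum.cong) auto
next
  fix v w :: "'i \<Rightarrow> nat" assume "\<forall>i\<in>I. v i = w i"
  then have "h t v = h t w" if "t \<in> T" for t
    using assms[OF that] unfolding alternating_relation_def by blast
  then show "(\<Sum>t\<in>T. x t * h t v) = (\<Sum>t\<in>T. x t * h t w)" by simp
next
  fix v :: "'i \<Rightarrow> nat" and j k assume "j \<in> I" "k < m"
  then have "(\<Sum>y\<in>V. h t (v(j := y)) * real y ^ k) = 0" if "t \<in> T" for t
    using assms[OF that] unfolding alternating_relation_def by blast
  then have "(\<Sum>t\<in>T. x t * (\<Sum>y\<in>V. h t (v(j := y)) * real y ^ k)) = 0" by simp
  then have "(\<Sum>t\<in>T. \<Sum>y\<in>V. x t * h t (v(j := y)) * real y ^ k) = 0"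
    by (simp add: sum_distrib_left mult.assoc)
  then show "(\<Sum>y\<in>V. (\<Sum>t\<in>T. x t * h t (v(j := y))) * real y ^ k) = 0"
    unfolding sum_distrib_right by (subst sum.swap)
qed

lemma same_image_permutes:
  assumes "inj_on v I" "inj_on w I" "v ` I = w ` I"
  obtains \<tau> where "\<tau> permutes I" "\<And>i. i \<in> I \<Longrightarrow> v i = w (\<tau> i)"
proof -
  define \<tau> where "\<tau> i = (if i \<in> I then inv_into I w (v i) else i)" for i
  have "bij_betw (\<lambda>i. inv_into I w (v i)) I I"
    using bij_betw_trans[of v I "w ` I" "inv_into I w" I] bij_betw_inv_into[of w I "w ` I"] assms
    unfolding comp_def by (simp add: bij_betw_def)
  then have "bij_betw \<tau> I I" unfolding \<tau>_def by (simp cong: bij_betw_cong)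
  then have "\<tau> permutes I" by (rule bij_imp_permutes) (simp add: \<tau>_def)
  moreover have "v i = w (\<tau> i)" if "i \<in> I" for i
  proof -
    have "v i \<in> w ` I" using that assms(3) by blast
    then show ?thesis using that unfolding \<tau>_def by (simp add: f_inv_into_f)
  qed
  ultimately show ?thesis using that by blast
qed

lemma alternating_relation_same_image:
  assumes h: "alternating_relation I V m h"
    and "inj_on v I" "inj_on w I" "v ` I = w ` I"
  shows "h v = 0 \<longleftrightarrow> h w = 0"
proof -
  obtain \<tau> where \<tau>: "\<tau> permutes I" "\<And>i. i \<in> I \<Longrightarrow> v i = w (\<tau> i)"
    using same_image_permutes[OF assms(2-4)] by blast
  have "\<forall>i\<in>I. v i = (w \<circ> \<tau>) i" using \<tau>(2) by simp
  then have "h v = h (w \<circ> \<tau>)" using h unfolding alternating_relation_def by blast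
  also have "\<dots> = of_int (sign \<tau>) * h w" using h \<tau>(1) unfolding alternating_relation_def by blast
  finally show ?thesis by simp
qed

lemma alternating_relation_repeated:
  assumes h: "alternating_relation I V m h" and v: "\<not> inj_on v I"
  shows "h v = 0"
proof -
  obtain i j where ij: "i \<in> I" "j \<in> I" "i \<noteq> j" "v i = v j" using v unfolding inj_on_def by blast
  have "v \<circ> transpose i j = v" using ij(4) by (auto simp: transpose_def fun_eq_iff)
  moreover have "h (v \<circ> transpose i j) = of_int (sign (transpose i j)) * h v"
    using h permutes_swap_id[OF ij(1,2)] unfolding alternating_relation_def by blast
  ultimately show ?thesis using ij(3) by (simp add: sign_swap_id)
qed

text \<open>
  The space of functions with \<open>m\<close> vanishing moments restricts injectively to the complement of \<open>P\<close>, because \<open>P\<close> has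
  at most \<open>m\<close> points; this is the same fact for its exterior power. The proof removes one vertex of \<open>P\<close> from the tuple at a
  time: as a function of that argument alone, \<open>h\<close> is supported on \<open>P\<close> and has \<open>m\<close> vanishing moments.
\<close>

lemma alternating_relation_determined:
  assumes h: "alternating_relation I V m h" and fin: "finite I" "finite V"
    and P: "P \<subseteq> V" "card P \<le> m"
    and zero: "\<And>v. inj_on v I \<Longrightarrow> v ` I \<subseteq> V - P \<Longrightarrow> h v = 0"
    and v: "v ` I \<subseteq> V"
  shows "h v = 0"
  using v
proof (induction "card {i \<in> I. v i \<in> P}" arbitrary: v)
  case 0
  then have "{i \<in> I. v i \<in> P} = {}" using fin(1) by simp
  then have "v ` I \<subseteq> V - P" using 0(2) by blast
  then show ?case using zero alternating_relation_repeated[OF h] by blast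
next
  case (Suc c)
  then obtain j where j: "j \<in> I" "v j \<in> P" by (metis (no_types, lifting) card.empty empty_Collect_eq nat.distinct(1))
  have out: "h (v(j := x)) = 0" if x: "x \<in> V - P" for x
  proof (rule Suc.hyps(1))
    have "{i \<in> I. (v(j := x)) i \<in> P} = {i \<in> I. v i \<in> P} - {j}" using x by auto
    then show "c = card {i \<in> I. (v(j := x)) i \<in> P}" using Suc.hyps(2) j fin(1) by simp
    show "v(j := x) ` I \<subseteq> V" using Suc.prems x by auto
  qed
  have "(\<Sum>x\<in>P. h (v(j := x)) * real x ^ k) = 0" if "k < m" for k
  proof -
    have "(\<Sum>x\<in>V. h (v(j := x)) * real x ^ k) = 0"
      using h j(1) that unfolding alternating_relation_def by blast
    moreover have "(\<Sum>x\<in>V. h (v(j := x)) * real x ^ k) = (\<Sum>x\<in>P. h (v(j := x)) * real x ^ k)"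
      using fin(2) P(1) out by (intro sum.mono_neutral_right) auto
    ultimately show ?thesis by simp
  qed
  then have "h (v(j := v j)) = 0"
    by (rule vanishing_moments[OF finite_subset[OF P(1) fin(2)] P(2) _ j(2)])
  then show ?case by simp
qed

text \<open>
  In each class choose \<open>s\<close> vertices, among them the vertex of the edge \<open>e\<close>, and a function supported exactly there
  with \<open>s - 1\<close> vanishing moments. In the wedge product of these functions only transversals of the classes can get a nonzero
  term, and since the classes are disjoint, each gets at most one, so nothing can cancel at \<open>e\<close>.
\<close>

lemma copy_relation:
  assumes S: "disjoint_family_on S {1..d}" and card: "\<And>i. i \<in> {1..d} \<Longrightarrow> s \<le> card (S i)"
    and s: "1 \<le> s" and V: "finite V" "\<And>i. i \<in> {1..d} \<Longrightarrow> S i \<subseteq> V"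
    and e: "e \<in> transversals d S"
  obtains h where "alternating_relation {1..d} V (s - 1) h"
    "\<And>v. inj_on v {1..d} \<Longrightarrow> v ` {1..d} \<notin> transversals d S \<Longrightarrow> h v = 0"
    "\<And>v. inj_on v {1..d} \<Longrightarrow> v ` {1..d} = e \<Longrightarrow> h v \<noteq> 0"
proof -
  obtain w where w0: "\<forall>i\<in>{1..d}. w i \<in> S i" and we: "e = w ` {1..d}"
    using iffD1[OF transversals_iff[OF S] e] by (elim exE conjE) (rule that)
  then have w: "w i \<in> S i" if "i \<in> {1..d}" for i using that by blast
  have "\<exists>Y. Y \<subseteq> S i \<and> w i \<in> Y \<and> finite Y \<and> card Y = s" if i: "i \<in> {1..d}" for i
  proof -
    have "finite (S i)" using V(2)[OF i] V(1) finite_subset by blast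
    then have "s - 1 \<le> card (S i - {w i})" using card[OF i] w[OF i] by simp
    then obtain Z where Z: "Z \<subseteq> S i - {w i}" "card Z = s - 1" "finite Z"
      by (meson obtain_subset_with_card_n)
    then have "w i \<notin> Z" by blast
    then have "card (insert (w i) Z) = s" using Z(2,3) s by simp
    then show ?thesis using Z w[OF i] by (intro exI[of _ "insert (w i) Z"]) auto
  qed
  then obtain Y where Y: "\<And>i. i \<in> {1..d} \<Longrightarrow> Y i \<subseteq> S i \<and> w i \<in> Y i \<and> finite (Y i) \<and> card (Y i) = s"
    by metis
  have "\<exists>a :: nat \<Rightarrow> real. (\<forall>x. a x \<noteq> 0 \<longleftrightarrow> x \<in> Y i) \<and> (\<forall>k<s - 1. (\<Sum>x\<in>Y i. a x * real x ^ k) = 0)"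
    if "i \<in> {1..d}" for i
    using moment_relation_exists[of "Y i" s] Y[OF that] s by blast
  then obtain a :: "nat \<Rightarrow> nat \<Rightarrow> real" where a: "\<And>i. i \<in> {1..d} \<Longrightarrow>
      (\<forall>x. a i x \<noteq> 0 \<longleftrightarrow> x \<in> Y i) \<and> (\<forall>k<s - 1. (\<Sum>x\<in>Y i. a i x * real x ^ k) = 0)"
    by metis
  have supp: "a i x \<noteq> 0 \<longleftrightarrow> x \<in> Y i" if "i \<in> {1..d}" for i x using a[OF that] by blast
  define h where "h = alternating_product {1..d} a"
  have rel: "alternating_relation {1..d} V (s - 1) h"
    unfolding h_def
  proof (rule alternating_product_relation)
    fix i k assume i: "i \<in> {1..d}" and k: "k < s - 1"
    have "(\<Sum>x\<in>V. a i x * real x ^ k) = (\<Sum>x\<in>Y i. a i x * real x ^ k)"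
    proof (rule sum.mono_neutral_right)
      show "Y i \<subseteq> V" using Y[OF i] V(2)[OF i] by blast
    qed (use V(1) supp[OF i] in auto)
    then show "(\<Sum>x\<in>V. a i x * real x ^ k) = 0" using a[OF i] k by simp
  qed simp
  \<comment> \<open>A permutation with a nonzero term would exhibit the tuple as a transversal.\<close>
  have out: "h v = 0" if v: "inj_on v {1..d}" "v ` {1..d} \<notin> transversals d S" for v
  proof -
    have "(\<Prod>i\<in>{1..d}. a i (v (\<pi> i))) = 0" if \<pi>: "\<pi> permutes {1..d}" for \<pi>
    proof (rule ccontr)
      assume "(\<Prod>i\<in>{1..d}. a i (v (\<pi> i))) \<noteq> 0"
      then have "\<forall>i\<in>{1..d}. v (\<pi> i) \<in> S i" using supp Y by fastforce
      then have "(\<lambda>i. v (\<pi> i)) ` {1..d} \<in> transversals d S"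
        unfolding transversals_iff[OF S] by (intro exI[of _ "\<lambda>i. v (\<pi> i)"] conjI refl)
      moreover have "(\<lambda>i. v (\<pi> i)) ` {1..d} = v ` {1..d}"
        using permutes_image[OF \<pi>] by (metis image_image)
      ultimately show False using v by simp
    qed
    then show ?thesis unfolding h_def alternating_product_def by (intro sum.neutral) auto
  qed
  have disj: "i = j" if "i \<in> {1..d}" "j \<in> {1..d}" "x \<in> S i" "x \<in> S j" for i j x
    using S that unfolding disjoint_family_on_def by blast
  have winj: "inj_on w {1..d}" using w disj by (metis inj_onI)
  have "h w \<noteq> 0"
  proof -
    have "(\<Prod>i\<in>{1..d}. a i (w (\<pi> i))) = 0" if \<pi>: "\<pi> permutes {1..d}" "\<pi> \<noteq> id" for \<pi>
    proof (rule ccontr)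
      assume "(\<Prod>i\<in>{1..d}. a i (w (\<pi> i))) \<noteq> 0"
      then have "\<forall>i\<in>{1..d}. w (\<pi> i) \<in> S i" using supp Y by fastforce
      then have "\<pi> i = i" if "i \<in> {1..d}" for i
        using disj[of "\<pi> i" i "w (\<pi> i)"] w[of "\<pi> i"] permutes_in_image[OF \<pi>(1), of i] that by blast
      then have "\<pi> i = i" for i using permutes_not_in[OF \<pi>(1)] by (cases "i \<in> {1..d}") auto
      then show False using \<pi>(2) by auto
    qed
    then have "h w = (\<Sum>\<pi>\<in>{id}. of_int (sign \<pi>) * (\<Prod>i\<in>{1..d}. a i (w (\<pi> i))))"
      unfolding h_def alternating_product_def
      by (intro sum.mono_neutral_right) (auto simp: finite_permutations permutes_id)
    also have "\<dots> = (\<Prod>i\<in>{1..d}. a i (w i))" by simp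
    also have "\<dots> \<noteq> 0" using supp Y by simp
    finally show ?thesis .
  qed
  then have "h v \<noteq> 0" if "inj_on v {1..d}" "v ` {1..d} = e" for v
    using alternating_relation_same_image[OF rel that(1) winj] that(2) we by simp
  then show ?thesis using that rel out by blast
qed

text \<open>
  Here \<open>es\<close> is the ordering of the missing edges, and \<open>h i\<close> is the relation attached to the copy that justifies \<open>es ! i\<close>. It
  vanishes at all later edges, since those lie outside that copy. With \<open>P\<close> the last
  \<open>s - 1\<close> vertices, a combination of the relations is determined by its values on the set \<open>D\<close> of edges avoiding \<open>P\<close>. If there were more than
  \<open>card D\<close> steps, a nontrivial combination would vanish on \<open>D\<close> and hence everywhere; but it does
  not vanish at the last edge whose relation has a nonzero coefficient.
\<close>

lemma wsat_complete_partite_lower: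
  assumes r: "\<And>i. i \<in> {1..d} \<Longrightarrow> s \<le> r i" and s: "1 \<le> s"
  shows "(n choose d) \<le> wsat_complete d n (complete_partite d r) + ((n - (s - 1)) choose d)"
proof -
  let ?F = "complete_hypergraph d n"
  obtain G where G: "weakly_saturated (complete_partite d r) ?F G"
    and cardG: "card G = wsat_complete d n (complete_partite d r)"
    using wsat_attained unfolding wsat_complete_def by blast
  obtain es where es: "G \<subseteq> ?F" "distinct es" "set es = ?F - G"
    and step: "\<forall>i<length es. \<exists>K. isomorphic_hypergraphs (complete_partite d r) K \<and>
       K \<subseteq> G \<union> set (take (Suc i) es) \<and> es ! i \<in> K"
    by (rule weakly_saturatedE[OF G])
  define V P D where "V = {..<n}" and "P = {n - (s - 1)..<n}" and "D = complete_hypergraph d (n - (s - 1))"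
  have "\<exists>v. bij_betw v {1..d} e" if "e \<in> ?F" for e
  proof -
    have "finite e" "card e = d" using that finite_subset unfolding complete_hypergraph_def by auto
    then show ?thesis by (metis card_atLeastAtMost diff_Suc_1 finite_atLeastAtMost finite_same_card_bij)
  qed
  \<comment> \<open>An enumeration of each edge, at which the alternating functions are evaluated.\<close>
  then obtain rep where rep: "\<And>e. e \<in> ?F \<Longrightarrow> bij_betw (rep e) {1..d} e" by metis
  have rep': "inj_on (rep e) {1..d}" "rep e ` {1..d} = e" if "e \<in> ?F" for e
    using rep[OF that] unfolding bij_betw_def by blast+
  have "\<exists>h. alternating_relation {1..d} V (s - 1) h \<and> h (rep (es ! i)) \<noteq> 0 \<and>
      (\<forall>j<length es. i < j \<longrightarrow> h (rep (es ! j)) = 0)" if i: "i < length es" for i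
  proof -
    obtain K where K: "isomorphic_hypergraphs (complete_partite d r) K"
       "K \<subseteq> G \<union> set (take (Suc i) es)" "es ! i \<in> K" using step i by blast
    have "1 \<le> r j" if "j \<in> {1..d}" for j using r[OF that] s by simp
    then obtain S where S: "disjoint_family_on S {1..d}"
      "\<And>j. j \<in> {1..d} \<Longrightarrow> finite (S j) \<and> card (S j) = r j" "K = transversals d S"
      by (rule isomorphic_complete_partiteE[OF K(1)]) auto
    have "set (take (Suc i) es) \<subseteq> ?F" using es(3) set_take_subset[of "Suc i" es] by blast
    then have KF: "K \<subseteq> ?F" using K(2) es(1) by blast
    have ne: "S j \<noteq> {}" if "j \<in> {1..d}" for j using S(2)[OF that] r[OF that] s by auto
    have "(\<Union>j\<in>{1..d}. S j) = \<Union>K" using Union_transversals[OF S(1) ne] S(3) by simp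
    also have "\<dots> \<subseteq> V" using KF unfolding V_def complete_hypergraph_def by blast
    finally have SV: "S j \<subseteq> V" if "j \<in> {1..d}" for j using that by blast
    obtain h where h: "alternating_relation {1..d} V (s - 1) h"
      "\<And>v. inj_on v {1..d} \<Longrightarrow> v ` {1..d} \<notin> transversals d S \<Longrightarrow> h v = 0"
      "\<And>v. inj_on v {1..d} \<Longrightarrow> v ` {1..d} = es ! i \<Longrightarrow> h v \<noteq> 0"
    proof (rule copy_relation[OF S(1) _ s _ SV])
      show "s \<le> card (S j)" if "j \<in> {1..d}" for j using S(2)[OF that] r[OF that] by simp
      show "es ! i \<in> transversals d S" using K(3) S(3) by simp
    qed (auto simp: V_def)
    have esF: "es ! j \<in> ?F" "es ! j \<notin> G" if "j < length es" for j
      using es(3) nth_mem[OF that] by auto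
    have "h (rep (es ! i)) \<noteq> 0" using h(3) rep'[OF esF(1)[OF i]] by blast
    moreover have "h (rep (es ! j)) = 0" if j: "j < length es" "i < j" for j
    proof (rule h(2))
      have "es ! j \<notin> set (take (Suc i) es)"
      proof
        assume "es ! j \<in> set (take (Suc i) es)"
        then obtain l where "l < Suc i" "l < length es" "es ! l = es ! j"
          by (auto simp: in_set_conv_nth)
        then show False using nth_eq_iff_index_eq[OF es(2), of l j] j by simp
      qed
      then show "rep (es ! j) ` {1..d} \<notin> transversals d S"
        using K(2) S(3) esF(2)[OF j(1)] rep'(2)[OF esF(1)[OF j(1)]] by auto
    qed (rule rep'(1)[OF esF(1)[OF j(1)]])
    ultimately show ?thesis using h(1) by blast
  qed
  then obtain h where h: "\<And>i. i < length es \<Longrightarrow> alternating_relation {1..d} V (s - 1) (h i) \<and>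
      h i (rep (es ! i)) \<noteq> 0 \<and> (\<forall>j<length es. i < j \<longrightarrow> h i (rep (es ! j)) = 0)"
    by metis
  have DF: "D \<subseteq> ?F" unfolding D_def complete_hypergraph_def by auto
  have "length es \<le> card D"
  proof (rule ccontr)
    assume "\<not> length es \<le> card D"
    then have "card D < card {..<length es}" by simp
    moreover have "finite D" unfolding D_def by (rule finite_complete_hypergraph)
    ultimately obtain x where x: "\<exists>i\<in>{..<length es}. x i \<noteq> 0"
      and eq: "\<forall>e\<in>D. (\<Sum>i\<in>{..<length es}. x i * h i (rep e)) = 0"
      using underdetermined_system[of D "{..<length es}" "\<lambda>i e. h i (rep e)"] by auto
    define g where "g = (\<lambda>v. \<Sum>i\<in>{..<length es}. x i * h i v)"
    have g: "alternating_relation {1..d} V (s - 1) g"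
      unfolding g_def by (rule alternating_relation_sum) (use h in auto)
    have gzero: "g v = 0" if "v ` {1..d} \<subseteq> V" for v
    proof (rule alternating_relation_determined[OF g _ _ _ _ _ that])
      fix v :: "nat \<Rightarrow> nat" assume v: "inj_on v {1..d}" "v ` {1..d} \<subseteq> V - P"
      have "V - P = {..<n - (s - 1)}" unfolding V_def P_def by auto
      then have D: "v ` {1..d} \<in> D"
        unfolding D_def using v by (intro complete_hypergraphI) (auto simp: card_image)
      then have "g (rep (v ` {1..d})) = 0" using eq unfolding g_def by blast
      then show "g v = 0"
        using alternating_relation_same_image[OF g v(1) rep'(1)] rep'(2) D DF by blast
    qed (auto simp: V_def P_def)
    define i where "i = Max {i. i < length es \<and> x i \<noteq> 0}"
    have i: "i < length es" "x i \<noteq> 0" "\<And>j. j < length es \<Longrightarrow> x j \<noteq> 0 \<Longrightarrow> j \<le> i"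
    proof -
      let ?N = "{i. i < length es \<and> x i \<noteq> 0}"
      have fin: "finite ?N" by simp
      have "?N \<noteq> {}" using x by blast
      then have "i \<in> ?N" unfolding i_def by (rule Max_in[OF fin])
      then show "i < length es" "x i \<noteq> 0" by simp_all
      show "j \<le> i" if "j < length es" "x j \<noteq> 0" for j
        unfolding i_def using that by (intro Max_ge[OF fin]) simp
    qed
    have esF: "es ! i \<in> ?F" using es(3) nth_mem[OF i(1)] by auto
    have "g (rep (es ! i)) = (\<Sum>j\<in>{i}. x j * h j (rep (es ! i)))"
      unfolding g_def
    proof (intro sum.mono_neutral_right ballI)
      fix j assume j: "j \<in> {..<length es} - {i}"
      show "x j * h j (rep (es ! i)) = 0"
      proof (cases "j < i")
        case True
        then show ?thesis using h[of j] i(1) j by auto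
      next
        case False
        then have "x j = 0" using i(3)[of j] j by auto
        then show ?thesis by simp
      qed
    qed (use i in auto)
    then have "g (rep (es ! i)) \<noteq> 0" using h[OF i(1)] i(2) by simp
    moreover have "rep (es ! i) ` {1..d} \<subseteq> V"
      using rep'(2)[OF esF] esF unfolding V_def complete_hypergraph_def by auto
    ultimately show False using gzero by blast
  qed
  moreover have "card ?F = card G + length es"
  proof -
    have "card (?F - G) = length es" using es(2,3) distinct_card by metis
    moreover have "finite G" using es(1) finite_complete_hypergraph finite_subset by blast
    then have "card (?F - G) = card ?F - card G" by (rule card_Diff_subset[OF _ es(1)])
    moreover have "card G \<le> card ?F" by (rule card_mono[OF finite_complete_hypergraph es(1)])
    ultimately show ?thesis by simp
  qed
  ultimately show ?thesis
    using cardG unfolding D_def card_complete_hypergraph by simp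
qed

section \<open>Asymptotics for complete partite hypergraphs\<close>

lemma binomial_add_ge: "(N choose d) + j * (N choose (d - 1)) \<le> (N + j) choose d" if "1 \<le> d"
proof (induction j)
  case (Suc j)
  have "Suc (N + j) choose d = ((N + j) choose (d - 1)) + ((N + j) choose d)"
    using that by (cases d) auto
  moreover have "N choose (d - 1) \<le> (N + j) choose (d - 1)" by (rule binomial_right_mono) simp
  ultimately show ?case using Suc by simp
qed simp

text \<open>
  Bernoulli's inequality. The subtraction on the right is truncated, but for \<open>j \<ge> n\<close> the left side is at most zero
  or \<open>k = 0\<close>.
\<close>

lemma power_minus_le: "real n ^ k - real j * real k * real n ^ (k - 1) \<le> real (n - j) ^ k"
proof (cases "j < n")
  case True
  have "1 + real k * (- (real j / real n)) \<le> (1 + - (real j / real n)) ^ k"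
    by (rule Bernoulli_inequality) (use True in simp)
  then have "real n ^ k * (1 - real k * (real j / real n)) \<le> real n ^ k * (1 - real j / real n) ^ k"
    by (intro mult_left_mono) auto
  also have "\<dots> = (real n * (1 - real j / real n)) ^ k" by (simp add: power_mult_distrib)
  also have "real n * (1 - real j / real n) = real (n - j)"
    using True by (simp add: field_simps)
  also have "real n ^ k * (1 - real k * (real j / real n)) = real n ^ k - real j * real k * real n ^ (k - 1)"
    using True by (cases k) (simp_all add: field_simps)
  finally show ?thesis .
next
  case False
  show ?thesis
  proof (cases "k = 0")
    case False
    have "real n ^ k = real n * real n ^ (k - 1)" using False by (cases k) auto
    also have "\<dots> \<le> (real j * real k) * real n ^ (k - 1)"
    proof (rule mult_right_mono)
      have "real n \<le> real j * 1" using \<open>\<not> j < n\<close> by simp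
      also have "\<dots> \<le> real j * real k" using False by (intro mult_left_mono) auto
      finally show "real n \<le> real j * real k" .
    qed simp
    finally show ?thesis using zero_le_power[of "real (n - j)" k] by linarith
  qed simp
qed

lemma binomial_le_power: "real (n choose k) \<le> real n ^ k / fact k"
proof -
  have "real ((n choose k) * fact k) \<le> real (n ^ k)" using binomial_fact_pow of_nat_mono by blast
  then show ?thesis by (simp add: field_simps)
qed

lemma power_le_binomial: "real (n - k) ^ k / fact k \<le> real (n choose k)"
proof -
  have "(n - k) ^ k \<le> fact k * (n choose k)"
  proof (induction k)
    case (Suc k)
    have absorb: "Suc k * (n choose Suc k) = (n - k) * (n choose k)"
      by (simp only: binomial_absorption binomial_absorb_comp)
    have "(n - Suc k) ^ Suc k \<le> (n - k) ^ Suc k" by (intro power_mono) auto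
    also have "\<dots> = (n - k) * (n - k) ^ k" by simp
    also have "\<dots> \<le> (n - k) * (fact k * (n choose k))" using Suc by (intro mult_left_mono) auto
    also have "\<dots> = fact k * ((n - k) * (n choose k))" by (simp only: mult_ac)
    also have "\<dots> = fact (Suc k) * (n choose Suc k)"
      unfolding absorb[symmetric] fact_Suc of_nat_id by (simp only: mult_ac)
    finally show ?case .
  qed simp
  then have "real ((n - k) ^ k) \<le> real (fact k * (n choose k))" by (rule of_nat_mono)
  then show ?thesis by (simp add: field_simps)
qed

text \<open>
  With \<open>k = d - 1\<close>, the upper bound gives \<open>(s - 1) n^k / k! + O(n^(k - 1))\<close> directly. For the lower bound, Pascal's rule
  turns \<open>(n choose d) - (N choose d)\<close> with \<open>N = n - (s - 1)\<close> into at least \<open>(s - 1) * (N choose k)\<close>, and \<open>N choose k\<close> differs from \<open>n^k / k!\<close> by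
  \<open>O(n^(k - 1))\<close>.
\<close>

lemma wsat_complete_partite_asymptotics:
  assumes d: "2 \<le> d" and r: "1 \<le> r 1" "mono_on {1..d} r"
  shows "(\<lambda>n. real (wsat_complete d n (complete_partite d r))
            - (real (r 1) - 1) / fact (d - 1) * real n ^ (d - 1))
        \<in> O(\<lambda>n. real n ^ (d - 2))"
proof -
  define s c k where "s = r 1" and "c = (\<Sum>i\<in>{1..d}. r i)" and "k = d - 1"
  define w where "w n = wsat_complete d n (complete_partite d r)" for n
  have k: "1 \<le> k" "d - 2 = k - 1" using d unfolding k_def by auto
  have rs: "s \<le> r i" if "i \<in> {1..d}" for i
    unfolding s_def using r(2) that by (auto simp: mono_on_def)
  have s1: "1 \<le> s" using r(1) s_def by simp
  define C where "C = max ((real c)\<^sup>2) (real (s - 1) * real (s - 1 + k) * real k / fact k)"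
  have "norm (real (w n) - (real s - 1) / fact k * real n ^ k) \<le> C * norm (real n ^ (k - 1))"
    if n: "n \<ge> c + s" for n
  proof -
    have "1 \<le> r i" if "i \<in> {1..d}" for i using rs[OF that] s1 by simp
    then have "w n \<le> (s - 1) * (n choose k) + c\<^sup>2 * (n choose (k - 1))"
      using wsat_complete_partite_upper[OF d, of r n] n unfolding w_def s_def c_def k_def k(2)[unfolded k_def]
      by simp
    then have "real (w n) \<le> real ((s - 1) * (n choose k) + c\<^sup>2 * (n choose (k - 1)))"
      by (rule of_nat_mono)
    also have "\<dots> = real (s - 1) * real (n choose k) + (real c)\<^sup>2 * real (n choose (k - 1))" by simp
    also have "\<dots> \<le> real (s - 1) * (real n ^ k / fact k) + (real c)\<^sup>2 * real n ^ (k - 1)"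
    proof (intro add_mono mult_left_mono binomial_le_power)
      have "real n ^ (k - 1) / fact (k - 1) \<le> real n ^ (k - 1) / 1"
        by (intro divide_left_mono) (auto simp: fact_ge_1)
      then show "real (n choose (k - 1)) \<le> real n ^ (k - 1)"
        using binomial_le_power[of n "k - 1"] by linarith
    qed auto
    also have "(real c)\<^sup>2 * real n ^ (k - 1) \<le> C * real n ^ (k - 1)"
      unfolding C_def by (intro mult_right_mono) auto
    finally have upper: "real (w n) - (real s - 1) / fact k * real n ^ k \<le> C * real n ^ (k - 1)"
      using s1 by (simp add: of_nat_diff)
    define N where "N = n - (s - 1)"
    have "(N choose d) + (s - 1) * (N choose (d - 1)) \<le> (N + (s - 1)) choose d"
      using d by (intro binomial_add_ge) simp
    moreover have "N + (s - 1) = n" using n unfolding N_def by simp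
    moreover have "n choose d \<le> w n + (N choose d)"
      unfolding w_def N_def by (rule wsat_complete_partite_lower[OF rs s1])
    ultimately have "(s - 1) * (N choose k) \<le> w n" unfolding k_def by simp
    then have "real ((s - 1) * (N choose k)) \<le> real (w n)" by (rule of_nat_mono)
    then have w: "real (s - 1) * real (N choose k) \<le> real (w n)" by simp
    have pow: "real (s - 1) * ((real n ^ k - real (s - 1 + k) * real k * real n ^ (k - 1)) / fact k)
        \<le> real (s - 1) * real (N choose k)"
    proof (rule mult_left_mono)
      have "n - (s - 1 + k) = N - k" unfolding N_def by simp
      then have "(real n ^ k - real (s - 1 + k) * real k * real n ^ (k - 1)) / fact k \<le> real (N - k) ^ k / fact k"
        using power_minus_le[of n k "s - 1 + k"] by (intro divide_right_mono) auto
      then show "(real n ^ k - real (s - 1 + k) * real k * real n ^ (k - 1)) / fact k \<le> real (N choose k)"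
        using power_le_binomial[of N k] by linarith
    qed simp
    have err: "real (s - 1) * real (s - 1 + k) * real k / fact k * real n ^ (k - 1) \<le> C * real n ^ (k - 1)"
      unfolding C_def by (intro mult_right_mono) auto
    have "real (s - 1) / fact k * real n ^ k - C * real n ^ (k - 1)
        \<le> real (s - 1) / fact k * real n ^ k - real (s - 1) * real (s - 1 + k) * real k / fact k * real n ^ (k - 1)"
      using err by (rule diff_left_mono)
    also have "\<dots> = real (s - 1) * ((real n ^ k - real (s - 1 + k) * real k * real n ^ (k - 1)) / fact k)"
      by (simp add: right_diff_distrib diff_divide_distrib mult.assoc)
    also note pow
    also note w
    finally have "(real s - 1) / fact k * real n ^ k - C * real n ^ (k - 1) \<le> real (w n)"
      using s1 by (simp add: of_nat_diff)
    then show ?thesis using upper by (simp add: abs_le_iff)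
  qed
  then have "(\<lambda>n. real (w n) - (real s - 1) / fact k * real n ^ k) \<in> O(\<lambda>n. real n ^ (k - 1))"
    by (intro bigoI[of _ C] eventually_sequentiallyI[of "c + s"])
  then show ?thesis unfolding w_def s_def k(2) k_def .
qed

section \<open>The two statements together\<close>

theorem theorem1p3:
  "(\<forall>H :: 'a set set. bipartite_graph H \<and> H \<noteq> {} \<longrightarrow>
      (\<exists>L :: real.
         (\<lambda>n. real (wsat_complete 2 n H) / real n) \<longlonglongrightarrow> L \<and>
         (\<lambda>n. real (wsat (complete_bipartite n n) H) / (2 * real n)) \<longlonglongrightarrow> L)) \<and>
   (\<forall>(d::nat) (r :: nat \<Rightarrow> nat). d \<ge> 2 \<and> 1 \<le> r 1 \<and> mono_on {1..d} r \<longrightarrow>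
      (\<lambda>n. real (wsat_complete d n (complete_partite d r))
            - (real (r 1) - 1) / fact (d - 1) * real n ^ (d - 1))
        \<in> O(\<lambda>n. real n ^ (d - 2)))"
  using wsat_bipartite_limits wsat_complete_partite_asymptotics by blast

end
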